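(* For every positive integer $n$, \[ W_{(2,7)}(n)=\tfrac{1}{600}\sigma_3(n)+\tfrac{1}{150}\sigma_3(\tfrac n2)+\tfrac{49}{600}\sigma_3(\tfrac n7)+\tfrac{49}{150}\sigma_3(\tfrac n{14})+(\tfrac1{24}-\tfrac{n}{28})\sigma(\tfrac n2)+(\tfrac1{24}-\tfrac n8)\sigma(\tfrac n7)-\tfrac1{600}a_1(n)-\tfrac1{4200}a_2(n)-\tfrac1{75}a_3(n)-\tfrac1{42}a_4(n). \]
   Context: $\sigma_k(n)=\sum_{d\mid n}d^k$ for $n\in\mathbb{N}$, $\sigma_k(x)=0$ for $x\notin\mathbb{N}$, $\sigma=\sigma_1$. $W_{(\alpha,\beta)}(n)=\sum_{(l,m)\in\mathbb{N}_0^2,\ \alpha l+\beta m=n}\sigma(l)\sigma(m)$. With $q=e^{2\pi iz}$ and $\eta(z)=q^{1/24}\prod_{n\ge1}(1-q^n)$, the integers $a_i(n)$ are defined by $A_i=\sum_{n\ge1}a_i(n)q^n$ where $A_1=\frac{\eta^5(z)\eta^5(7z)}{\eta(2z)\eta(14z)}$, $A_2=\eta^2(z)\eta^2(2z)\eta^2(7z)\eta^2(14z)$, $A_3=\frac{\eta^5(2z)\eta^5(14z)}{\eta(z)\eta(7z)}$, $A_4=\frac{\eta^6(z)\eta^6(14z)}{\eta^2(2z)\eta^2(7z)}$. *)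

theory Defs
  imports "HOL-Computational_Algebra.Formal_Power_Series"
begin

definition sigma_k :: "nat \<Rightarrow> nat \<Rightarrow> real" where
  "sigma_k k n = (if n = 0 then 0 else (\<Sum>d \<in> {d. d dvd n}. real d ^ k))"

definition sigma_k_frac :: "nat \<Rightarrow> nat \<Rightarrow> nat \<Rightarrow> real" where
  "sigma_k_frac k n c = (if c dvd n then sigma_k k (n div c) else 0)"

definition W :: "nat \<Rightarrow> nat \<Rightarrow> nat \<Rightarrow> real" where
  "W \<alpha> \<beta> n = (\<Sum>(l, m) \<in> {(l, m). l \<le> n \<and> m \<le> n \<and> \<alpha> * l + \<beta> * m = n}.
                  sigma_k 1 l * sigma_k 1 m)"

text \<open>Truncation of prod_{k>=1} (1 - q^(d k)) to the factors k = 1..N; for the coefficient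
  of q^n with n <= N the truncation is exact.\<close>
definition eta_trunc :: "nat \<Rightarrow> nat \<Rightarrow> real fps" where
  "eta_trunc d N = (\<Prod>k \<in> {1..N}. (1 - fps_X ^ (d * k)))"

text \<open>q-coefficients of the eta quotients A_1..A_4 (the powers of q^(1/24) combine to q^1, q^2, q^3, q^3).\<close>
definition a1 :: "nat \<Rightarrow> real" where
  "a1 n = fps_nth (fps_X ^ 1 * eta_trunc 1 n ^ 5 * eta_trunc 7 n ^ 5
                    * inverse (eta_trunc 2 n * eta_trunc 14 n)) n"

definition a2 :: "nat \<Rightarrow> real" where
  "a2 n = fps_nth (fps_X ^ 2 * eta_trunc 1 n ^ 2 * eta_trunc 2 n ^ 2
                    * eta_trunc 7 n ^ 2 * eta_trunc 14 n ^ 2) n"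

definition a3 :: "nat \<Rightarrow> real" where
  "a3 n = fps_nth (fps_X ^ 3 * eta_trunc 2 n ^ 5 * eta_trunc 14 n ^ 5
                    * inverse (eta_trunc 1 n * eta_trunc 7 n)) n"

definition a4 :: "nat \<Rightarrow> real" where
  "a4 n = fps_nth (fps_X ^ 3 * eta_trunc 1 n ^ 6 * eta_trunc 14 n ^ 6
                    * inverse (eta_trunc 2 n ^ 2 * eta_trunc 7 n ^ 2)) n"

end

theory Submission
  imports Defs
begin

unbundle fps_syntax

text \<open>Let \<open>\<theta> = q d/dq\<close>. The series \<open>d P(q\<^sup>d)\<close>,
  \<open>d\<^sup>2 Q(q\<^sup>d)\<close>, \<open>d\<^sup>3 R(q\<^sup>d)\<close> built from
  Ramanujan's \<open>P\<close>, \<open>Q\<close>, \<open>R\<close> solve Ramanujan's system,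
  which is equivalent to four divisor-sum convolutions and hence to an elementary shear of
  the solutions of \<open>a x + b y = n\<close>. For \<open>d\<close> dividing 14 they are
  polynomials in the quasimodular
  \<open>Z = (\<Sum>d | d dvd 14. d P(q\<^sup>d)) / 24\<close> and in five eta quotients
  \<open>a, b, c, e, f\<close> of weight 2, where
  \<open>f = \<eta>(z) \<eta>(2z) \<eta>(7z) \<eta>(14z)\<close>,
  \<open>A\<^sub>1 = f a\<close>, \<open>A\<^sub>2 = f\<^sup>2\<close>,
  \<open>8 A\<^sub>3 = f b\<close> and \<open>A\<^sub>4 = f c\<close>.

  No modular transformation is used to prove these polynomial identities. The vector of
  their errors \<open>r\<close> satisfies \<open>\<theta> r = M r\<close> for an explicit
  matrix \<open>M\<close> of power series, because the conjectured identities are compatible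
  with \<open>\<theta>\<close>. The matrix \<open>M\<close> at \<open>q = 0\<close> has norm
  at most 18 for a suitable weighted norm, so the vanishing of the coefficients of
  \<open>r\<close> below \<open>q\<^sup>1\<^sup>9\<close>, which is checked directly,
  propagates to all of them. The product \<open>P(q\<^sup>2) P(q\<^sup>7)\<close> is then
  read off from the squares of \<open>2 P(q\<^sup>2)\<close>, \<open>7 P(q\<^sup>7)\<close>
  and of their difference.\<close>

section \<open>Liouville--Skoruppa sums over \<open>a x + b y = n\<close>\<close>

definition quads :: "nat \<Rightarrow> (nat \<times> nat \<times> nat \<times> nat) set" where
  "quads n = {(a, b, x, y). 0 < a \<and> 0 < b \<and> 0 < x \<and> 0 < y \<and> a * x + b * y = n}"

lemma finite_quads: "finite (quads n)"
proof (rule finite_subset)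
  show "quads n \<subseteq> {..n} \<times> {..n} \<times> {..n} \<times> {..n}"
  proof (clarsimp simp: quads_def)
    fix a b x y :: nat assume h: "0 < a" "0 < b" "0 < x" "0 < y"
    have "a * 1 \<le> a * x" "1 * x \<le> a * x" "b * 1 \<le> b * y" "1 * y \<le> b * y"
      using h by (intro mult_le_mono; simp)+
    then show "a \<le> a * x + b * y \<and> b \<le> a * x + b * y \<and> x \<le> a * x + b * y \<and> y
        \<le> a * x + b * y"
      by linarith
  qed
qed simp

lemma quads_swap_iff: "(b, a, y, x) \<in> quads n \<longleftrightarrow> (a, b, x, y) \<in> quads n"
  by (auto simp: quads_def add.commute)

lemma quads_shear_iff: "y < x \<Longrightarrow> (a, a + b, x - y, y) \<in> quads n
    \<longleftrightarrow> a > 0 \<and> y > 0 \<and> a * x + b * y = n"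
  by (auto simp: quads_def add_mult_distrib diff_mult_distrib2 add.assoc [symmetric])

text \<open>\<open>a * (x - y) + (a + b) * y = a * x + b * y\<close>, so the shear to
  \<open>(a, a + b, x - y, y)\<close> stays in \<open>quads n\<close>. The cuts \<open>y < x\<close>
  and \<open>a < b\<close> express that \<open>x - y\<close>, respectively the recovered
  \<open>b\<close>, is positive.\<close>

lemma sum_quads_shear:
  "(\<Sum>(a, b, x, y) \<in> {(a, b, x, y) \<in> quads n. y < x}. F a b)
     = (\<Sum>(a, b, x, y) \<in> {(a, b, x, y) \<in> quads n. a < b}. F a (b - a))"
proof (rule sum.reindex_bij_witness[where i = "\<lambda>(a, b, x, y). (a, b - a, x + y, y)"
        and j = "\<lambda>(a, b, x, y). (a, a + b, x - y, y)"])
  fix q assume "q \<in> {(a, b, x, y) \<in> quads n. y < x}"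
  then show "(case case q of (a, b, x, y) \<Rightarrow> (a, a + b, x - y, y) of (a, b, x, y)
      \<Rightarrow> (a, b - a, x + y, y)) = q"
     "(case q of (a, b, x, y) \<Rightarrow> (a, a + b, x - y, y)) \<in> {(a, b, x, y) \<in> quads n. a
         < b}"
     "(case case q of (a, b, x, y) \<Rightarrow> (a, a + b, x - y, y) of (a, b, x, y) \<Rightarrow> F a
         (b - a)) =
         (case q of (a, b, x, y) \<Rightarrow> F a b)"
    by (auto simp: quads_shear_iff) (auto simp: quads_def)
next
  fix q assume "q \<in> {(a, b, x, y) \<in> quads n. a < b}"
  then obtain a b x y where q: "q = (a, b, x, y)" "(a, b, x, y) \<in> quads n" "a < b" by auto
  define b' where "b' = b - a"
  have b: "b = a + b'" using q(3) by (simp add: b'_def)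
  show "(case case q of (a, b, x, y) \<Rightarrow> (a, b - a, x + y, y) of (a, b, x, y) \<Rightarrow>
      (a, a + b, x - y, y)) = q"
     "(case q of (a, b, x, y) \<Rightarrow> (a, b - a, x + y, y)) \<in> {(a, b, x, y) \<in> quads n. y
         < x}"
    using q unfolding b by (auto simp: quads_def add_mult_distrib add_mult_distrib2)
qed

lemma sum_quads_swap:
  "(\<Sum>(a, b, x, y) \<in> {(a, b, x, y) \<in> quads n. P a b x y}. F a b)
     = (\<Sum>(a, b, x, y) \<in> {(a, b, x, y) \<in> quads n. P b a y x}. F b a)"
  by (rule sum.reindex_bij_witness[where i = "\<lambda>(a, b, x, y). (b, a, y, x)" and j =
      "\<lambda>(a, b, x, y). (b, a, y, x)"])
     (auto simp: quads_swap_iff)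

text \<open>The hypotheses say that \<open>F\<close> is an even symmetric function of the triple
  \<open>(a, b, - a - b)\<close>. Cutting the sum of \<open>F a b\<close> at
  \<open>x = y\<close> and shearing both halves gives the sum of \<open>F a (- b)\<close>,
  cut at \<open>a = b\<close>.\<close>
lemma sum_quads_minus:
  fixes F :: "real \<Rightarrow> real \<Rightarrow> real"
  assumes sym: "\<And>a b. F a b = F b a" and even: "\<And>a b. F (- a) (- b) = F a b"
    and rot: "\<And>a b. F a (b - a) = F a (- b)"
  shows "(\<Sum>(a, b, x, y) \<in> quads n. F (real a) (real b) - F (real a) (- real b))
     = (\<Sum>(a, b, x, y) \<in> {(a, b, x, y) \<in> quads n. x = y}. F (real a) (real b))
     - (\<Sum>(a, b, x, y) \<in> {(a, b, x, y) \<in> quads n. a = b}. F (real a) (- real b))"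
proof -
  have minus: "F a (- b) = F b (- a)" for a b
    by (metis even minus_minus sym)
  have split: "(\<Sum>q \<in> quads n. G q) = (\<Sum>q \<in> {q \<in> quads n. P q}. G q) + (\<Sum>q
      \<in> {q \<in> quads n. Q q}. G q)
      + (\<Sum>q \<in> {q \<in> quads n. R q}. G q)"
    if "\<And>q. (P q \<and> \<not> Q q \<and> \<not> R q) \<or> (\<not> P q \<and> Q q \<and> \<not> R
        q) \<or> (\<not> P q \<and> \<not> Q q \<and> R q)"
    for G :: "nat \<times> nat \<times> nat \<times> nat \<Rightarrow> real" and P Q R
  proof -
    have "quads n = ({q \<in> quads n. P q} \<union> {q \<in> quads n. Q q}) \<union> {q \<in> quads n.
        R q}"
      using that by blast
    also have "sum G \<dots> = sum G ({q \<in> quads n. P q} \<union> {q \<in> quads n. Q q}) + sum G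
        {q \<in> quads n. R q}"
      using that by (intro sum.union_disjoint) (auto simp: finite_quads)
    also have "sum G ({q \<in> quads n. P q} \<union> {q \<in> quads n. Q q})
        = sum G {q \<in> quads n. P q} + sum G {q \<in> quads n. Q q}"
      using that by (intro sum.union_disjoint) (auto simp: finite_quads)
    finally show ?thesis .
  qed
  have A: "(\<Sum>(a, b, x, y) \<in> {(a, b, x, y) \<in> quads n. y < x}. F (real a) (real b))
      = (\<Sum>(a, b, x, y) \<in> {(a, b, x, y) \<in> quads n. a < b}. F (real a) (- real b))"
    unfolding sum_quads_shear by (rule sum.cong) (auto simp: of_nat_diff rot)
  \<comment> \<open>Exchanging the two products reduces the half \<open>x < y\<close> to the half
    just sheared; exchanging back turns \<open>a < b\<close> into \<open>b < a\<close>.\<close>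
  have "(\<Sum>(a, b, x, y) \<in> {(a, b, x, y) \<in> quads n. x < y}. F (real a) (real b))
      = (\<Sum>(a, b, x, y) \<in> {(a, b, x, y) \<in> quads n. y < x}. F (real a) (real b))"
    by (subst sum_quads_swap) (simp add: sym)
  also note A
  also have "(\<Sum>(a, b, x, y) \<in> {(a, b, x, y) \<in> quads n. a < b}. F (real a) (- real b))
      = (\<Sum>(a, b, x, y) \<in> {(a, b, x, y) \<in> quads n. b < a}. F (real a) (- real b))"
    by (subst sum_quads_swap) (simp add: minus)
  finally have B: "(\<Sum>(a, b, x, y) \<in> {(a, b, x, y) \<in> quads n. x < y}. F (real a) (real b))
      = (\<Sum>(a, b, x, y) \<in> {(a, b, x, y) \<in> quads n. b < a}. F (real a) (- real b))" .
  have C: "(\<Sum>(a, b, x, y) \<in> quads n. F (real a) (real b))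
      = (\<Sum>(a, b, x, y) \<in> {(a, b, x, y) \<in> quads n. y < x}. F (real a) (real b))
      + (\<Sum>(a, b, x, y) \<in> {(a, b, x, y) \<in> quads n. x < y}. F (real a) (real b))
      + (\<Sum>(a, b, x, y) \<in> {(a, b, x, y) \<in> quads n. x = y}. F (real a) (real b))"
    unfolding split_def prod.collapse by (rule split) auto
  have D: "(\<Sum>(a, b, x, y) \<in> quads n. F (real a) (- real b))
      = (\<Sum>(a, b, x, y) \<in> {(a, b, x, y) \<in> quads n. a < b}. F (real a) (- real b))
      + (\<Sum>(a, b, x, y) \<in> {(a, b, x, y) \<in> quads n. b < a}. F (real a) (- real b))
      + (\<Sum>(a, b, x, y) \<in> {(a, b, x, y) \<in> quads n. a = b}. F (real a) (- real b))"
    unfolding split_def prod.collapse by (rule split) auto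
  have "(\<Sum>(a, b, x, y) \<in> quads n. F (real a) (real b) - F (real a) (- real b))
      = (\<Sum>(a, b, x, y) \<in> quads n. F (real a) (real b)) - (\<Sum>(a, b, x, y) \<in> quads n. F
          (real a) (- real b))"
    by (simp add: split_def sum_subtractf)
  then show ?thesis using A B C D by linarith
qed

text \<open>With \<open>x = y\<close> the equation is \<open>(a + b) * x = n\<close>: the divisor is
  \<open>d = a + b\<close>, and \<open>a\<close> runs from \<open>1\<close> to
  \<open>d - 1\<close>.\<close>

lemma sum_quads_eq_right:
  assumes "n > 0"
  shows "(\<Sum>(a, b, x, y) \<in> {(a, b, x, y) \<in> quads n. x = y}. F a b)
    = (\<Sum>d | d dvd n. \<Sum>a = 1..<d. F a (d - a))"
proof -
  have fin: "finite {d. d dvd n}" using assms by simp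
  have "(\<Sum>(d, a) \<in> Sigma {d. d dvd n} (\<lambda>d. {1..<d}). F a (d - a))
      = (\<Sum>(a, b, x, y) \<in> {(a, b, x, y) \<in> quads n. x = y}. F a b)"
    by (rule sum.reindex_bij_witness[where j = "\<lambda>(d, a). (a, d - a, n div d, n div d)"
          and i = "\<lambda>(a, b, x, y). (a + b, a)"])
       (use assms in \<open>auto simp: quads_def simp flip: add_mult_distrib\<close>)
  then show ?thesis using fin by (subst (asm) sum.Sigma[symmetric]) auto
qed

text \<open>With \<open>a = b = d\<close> the equation is \<open>d * (x + y) = n\<close>, and
  \<open>x + y = n div d\<close> has \<open>n div d - 1\<close> positive solutions.\<close>

lemma sum_quads_eq_left:
  assumes "n > 0"
  shows "(\<Sum>(a, b, x, y) \<in> {(a, b, x, y) \<in> quads n. a = b}. F a b)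
    = (\<Sum>d | d dvd n. of_nat (n div d - 1) * (F d d :: real))"
proof -
  have fin: "finite {d. d dvd n}" using assms by simp
  have le: "d * x \<le> n" if "x < n div d" for d x
    using mult_le_mono2[of x "n div d" d] times_div_less_eq_dividend[of d n] that by linarith
  have "(\<Sum>(d, x) \<in> Sigma {d. d dvd n} (\<lambda>d. {1..<n div d}). F d d)
      = (\<Sum>(a, b, x, y) \<in> {(a, b, x, y) \<in> quads n. a = b}. F a b)"
    by (rule sum.reindex_bij_witness[where j = "\<lambda>(d, x). (d, d, x, n div d - x)"
          and i = "\<lambda>(a, b, x, y). (a, x)"])
       (use assms in \<open>auto simp: quads_def diff_mult_distrib2 dvd_div_mult_self
          le simp flip: add_mult_distrib2 intro!: Nat.gr0I\<close>)
  then show ?thesis using fin by (subst (asm) sum.Sigma[symmetric]) auto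
qed

text \<open>Put \<open>k = a * x\<close> and \<open>n - k = b * y\<close>; the end terms vanish
  because the divisor sum is 0 at 0.\<close>

lemma sum_sigma_k_conv:
  "(\<Sum>k = 0..n. sigma_k i k * sigma_k j (n - k))
    = (\<Sum>(a, b, x, y) \<in> quads n. real a ^ i * real b ^ j)"
proof -
  have fin: "finite {d. d dvd k}" if "k \<in> {1..<n}" for k :: nat using that by auto
  have "(\<Sum>k = 0..n. sigma_k i k * sigma_k j (n - k)) = (\<Sum>k \<in> {1..<n}. sigma_k i k *
      sigma_k j (n - k))"
    by (rule sum.mono_neutral_right) (auto simp: sigma_k_def)
  also have "\<dots> = (\<Sum>k \<in> {1..<n}. \<Sum>(a, b) \<in> {d. d dvd k} \<times> {d. d dvd (n -
      k)}. real a ^ i * real b ^ j)"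
    by (rule sum.cong) (auto simp: sigma_k_def sum_product sum.cartesian_product)
  also have "\<dots> = (\<Sum>(k, a, b) \<in> Sigma {1..<n} (\<lambda>k. {d. d dvd k} \<times> {d. d
      dvd (n - k)}). real a ^ i * real b ^ j)"
    by (subst sum.Sigma) (auto simp: split_def)
  also have "\<dots> = (\<Sum>(a, b, x, y) \<in> quads n. real a ^ i * real b ^ j)"
    by (rule sum.reindex_bij_witness[where j = "\<lambda>(k, a, b). (a, b, k div a, (n - k) div b)"
          and i = "\<lambda>(a, b, x, y). (a * x, a, b)"])
       (auto simp: quads_def dvd_div_eq_0_iff intro!: Nat.gr0I)
  finally show ?thesis .
qed

section \<open>Convolutions of divisor sums\<close>

text \<open>Turns both boundary sums of \<open>sum_quads_minus\<close> into divisor sums. A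
  convolution identity then needs only a suitable form \<open>F\<close> and a closed form
  \<open>G\<close> of its power sum.\<close>

lemma sum_quads_minus_divisors:
  fixes F :: "real \<Rightarrow> real \<Rightarrow> real"
  assumes sym: "\<And>a b. F a b = F b a" and even: "\<And>a b. F (- a) (- b) = F a b"
    and rot: "\<And>a b. F a (b - a) = F a (- b)"
    and G: "\<And>d. d > 0 \<Longrightarrow> (\<Sum>a = 1..<d. F (real a) (real d - real a)) = G (real
        d)"
    and n: "n > 0"
  shows "(\<Sum>(a, b, x, y) \<in> quads n. F (real a) (real b) - F (real a) (- real b))
     = (\<Sum>d | d dvd n. G (real d) - (real n / real d - 1) * F (real d) (- real d))"
proof -
  have "(\<Sum>d | d dvd n. \<Sum>a = 1..<d. F (real a) (real (d - a))) = (\<Sum>d | d dvd n. G (real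
      d))"
  proof (rule sum.cong)
    fix d assume "d \<in> {d. d dvd n}"
    then have "d > 0" using n by (auto intro: Nat.gr0I)
    have "(\<Sum>a = 1..<d. F (real a) (real (d - a))) = (\<Sum>a = 1..<d. F (real a) (real d - real
        a))"
      by (rule sum.cong) (auto simp: of_nat_diff)
    then show "(\<Sum>a = 1..<d. F (real a) (real (d - a))) = G (real d)" using G[OF \<open>d >
        0\<close>] by simp
  qed simp
  moreover have "(\<Sum>d | d dvd n. real (n div d - 1) * F (real d) (- real d))
      = (\<Sum>d | d dvd n. (real n / real d - 1) * F (real d) (- real d))"
  proof (rule sum.cong)
    fix d assume "d \<in> {d. d dvd n}"
    then have "n div d \<ge> 1" "real (n div d) = real n / real d"
      using n by (auto simp: real_of_nat_div dvd_div_eq_0_iff Suc_le_eq intro!: Nat.gr0I)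
    then show "real (n div d - 1) * F (real d) (- real d) = (real n / real d - 1) * F (real d) (- real
        d)"
      by (simp add: of_nat_diff)
  qed simp
  ultimately show ?thesis
    using sum_quads_minus[of F n, OF sym even rot]
      sum_quads_eq_right[of n "\<lambda>a b. F (real a) (real b)", OF n]
      sum_quads_eq_left[of n "\<lambda>a b. F (real a) (- real b)", OF n]
    by (simp add: sum_subtractf)
qed

text \<open>For odd \<open>k\<close>, the Eisenstein series of weight \<open>k + 1\<close> up to a
  scalar and without its constant term.\<close>

definition lambert :: "nat \<Rightarrow> real fps" where
  "lambert k = Abs_fps (sigma_k k)"

lemma lambert_nth: "lambert k $ n = sigma_k k n"
  by (simp add: lambert_def)

lemma sigma_k_0 [simp]: "sigma_k k 0 = 0"
  by (simp add: sigma_k_def)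

lemma sigma_k_pos: "n > 0 \<Longrightarrow> sigma_k k n = (\<Sum>d | d dvd n. real d ^ k)"
  by (simp add: sigma_k_def)

lemma lambert_mult_nth: "(lambert i * lambert j) $ n = (\<Sum>(a, b, x, y) \<in> quads n. real a ^ i *
    real b ^ j)"
  by (simp add: fps_mult_nth lambert_nth sum_sigma_k_conv)

lemma divisor_pos: "n > 0 \<Longrightarrow> d \<in> {d. d dvd n} \<Longrightarrow> 0 < (d :: nat)"
  by (auto intro: Nat.gr0I)

lemma sum_powers:
  fixes m :: nat
  shows "(\<Sum>a = 1..<Suc m. real a) = real m * (real m + 1) / 2"
    and "(\<Sum>a = 1..<Suc m. real a ^ 2) = real m * (real m + 1) * (2 * real m + 1) / 6"
    and "(\<Sum>a = 1..<Suc m. real a ^ 3) = (real m * (real m + 1) / 2) ^ 2"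
    and "(\<Sum>a = 1..<Suc m. real a ^ 4)
      = real m * (real m + 1) * (2 * real m + 1) * (3 * real m ^ 2 + 3 * real m - 1) / 30"
    and "(\<Sum>a = 1..<Suc m. real a ^ 5)
      = real m ^ 2 * (real m + 1) ^ 2 * (2 * real m ^ 2 + 2 * real m - 1) / 12"
    and "(\<Sum>a = 1..<Suc m. real a ^ 6)
      = real m * (real m + 1) * (2 * real m + 1) * (3 * real m ^ 4 + 6 * real m ^ 3 - 3 * real m + 1) /
          42"
  by (induction m; simp add: field_simps eval_nat_numeral)+

text \<open>The four convolutions come from \<open>e\<^sub>2\<close>,
  \<open>e\<^sub>2\<^sup>2\<close>, \<open>e\<^sub>3\<^sup>2\<close> and
  \<open>e\<^sub>2\<^sup>3\<close>, where
  \<open>e\<^sub>2 = a\<^sup>2 + a b + b\<^sup>2\<close> and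
  \<open>e\<^sub>3 = a b (a + b)\<close> are, up to sign, the elementary symmetric functions
  of \<open>(a, b, - a - b)\<close>.\<close>
lemma lambert_1_1: "12 * lambert 1 ^ 2 = 5 * lambert 3 + lambert 1 - 6 * fps_XD (lambert 1)"
proof (rule fps_ext)
  fix n
  define F where "F a b = a ^ 2 + a * b + b ^ 2" for a b :: real
  have S: "(\<Sum>a = 1..<d. F (real a) (real d - real a)) = 5 / 6 * real d ^ 3 - real d ^ 2 + 1 / 6 *
      real d"
    if "d > 0" for d
  proof -
    obtain m where d: "d = Suc m" using \<open>d > 0\<close> gr0_implies_Suc by blast
    have "(\<Sum>a = 1..<d. F (real a) (real d - real a)) = (\<Sum>a = 1..<d. real a ^ 2 - real d *
        real a + real d ^ 2)"
      by (rule sum.cong) (auto simp: F_def eval_nat_numeral algebra_simps)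
    also have "\<dots> = (\<Sum>a = 1..<d. real a ^ 2) - real d * (\<Sum>a = 1..<d. real a) + real (d -
        1) * real d ^ 2"
      by (simp add: sum.distrib sum_subtractf sum_distrib_left)
    also have "\<dots> = 5 / 6 * real d ^ 3 - real d ^ 2 + 1 / 6 * real d"
      unfolding d sum_powers by (simp add: field_simps eval_nat_numeral)
    finally show ?thesis .
  qed
  show "(12 * lambert 1 ^ 2) $ n = (5 * lambert 3 + lambert 1 - 6 * fps_XD (lambert 1)) $ n"
  proof (cases "n > 0")
    case True
    \<comment> \<open>\<open>F a b - F a (- b) = 2 * a * b\<close>.\<close>
    have "2 * (lambert 1 ^ 2) $ n = (\<Sum>(a, b, x, y) \<in> quads n. F (real a) (real b) - F (real a)
        (- real b))"
      unfolding power2_eq_square [of "lambert _"] lambert_mult_nth sum_distrib_left sum.distrib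
          [symmetric]
      by (rule sum.cong) (auto simp: F_def eval_nat_numeral algebra_simps)
    also have "\<dots> = (\<Sum>d | d dvd n. 5 / 6 * real d ^ 3 - real d ^ 2 + 1 / 6 * real d
        - (real n / real d - 1) * F (real d) (- real d))"
      by (rule sum_quads_minus_divisors[OF _ _ _ S True]) (auto simp: F_def algebra_simps
          eval_nat_numeral)
    \<comment> \<open>\<open>F d (- d) = d ^ 2\<close>, so the boundary term is
      \<open>n * d - d ^ 2\<close>: its square cancels the even power of \<open>d\<close> from the
      power sum, and \<open>n * d\<close> yields the derivative.\<close>
    also have "\<dots> = (\<Sum>d | d dvd n. 5 / 6 * real d ^ 3 + 1 / 6 * real d ^ 1 - real n * real d
        ^ 1)"
      by (rule sum.cong) (use divisor_pos[OF True] in \<open>auto simp: F_def field_simps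
          eval_nat_numeral\<close>)
    also have "\<dots> = 5 / 6 * sigma_k 3 n + 1 / 6 * sigma_k 1 n - real n * sigma_k 1 n"
      by (simp only: sigma_k_pos[OF True] sum.distrib sum_subtractf sum_distrib_left)
    finally show ?thesis
      by (simp add: numeral_fps_const lambert_nth ; simp add: algebra_simps)
  qed (simp_all add: power2_eq_square lambert_nth)
qed

lemma lambert_1_3: "240 * (lambert 1 * lambert 3) = 21 * lambert 5 + 10 * lambert 3 - lambert 1 - 30 *
    fps_XD (lambert 3)"
proof (rule fps_ext)
  fix n
  define F where "F a b = (a ^ 2 + a * b + b ^ 2) ^ 2" for a b :: real
  have S: "(\<Sum>a = 1..<d. F (real a) (real d - real a)) = 7 / 10 * real d ^ 5 - real d ^ 4 + 1 / 3 *
      real d ^ 3 - 1 / 30 * real d"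
    if "d > 0" for d
  proof -
    obtain m where d: "d = Suc m" using \<open>d > 0\<close> gr0_implies_Suc by blast
    have "(\<Sum>a = 1..<d. F (real a) (real d - real a)) = (\<Sum>a = 1..<d. real a ^ 4 - 2 * real d *
        real a ^ 3 + 3 * real d ^ 2 * real a ^ 2 - 2 * real d ^ 3 * real a + real d ^ 4)"
      by (rule sum.cong) (auto simp: F_def eval_nat_numeral algebra_simps)
    also have "\<dots> = (\<Sum>a = 1..<d. real a ^ 4) - 2 * real d * (\<Sum>a = 1..<d. real a ^ 3) + 3
        * real d ^ 2 * (\<Sum>a = 1..<d. real a ^ 2) - 2 * real d ^ 3 * (\<Sum>a = 1..<d. real a) +
        real (d - 1) * real d ^ 4"
      by (simp add: sum.distrib sum_subtractf sum_distrib_left)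
    also have "\<dots> = 7 / 10 * real d ^ 5 - real d ^ 4 + 1 / 3 * real d ^ 3 - 1 / 30 * real d"
      unfolding d sum_powers by (simp add: field_simps eval_nat_numeral)
    finally show ?thesis .
  qed
  show "(240 * (lambert 1 * lambert 3)) $ n = (21 * lambert 5 + 10 * lambert 3 - lambert 1 - 30 *
      fps_XD (lambert 3)) $ n"
  proof (cases "n > 0")
    case True
    \<comment> \<open>\<open>F a b - F a (- b) = 4 * a ^ 3 * b + 4 * a * b ^ 3\<close>.\<close>
    have "4 * (lambert 3 * lambert 1) $ n + 4 * (lambert 1 * lambert 3) $ n = (\<Sum>(a, b, x, y) \<in>
        quads n. F (real a) (real b) - F (real a) (- real b))"
      unfolding power2_eq_square [of "lambert _"] lambert_mult_nth sum_distrib_left sum.distrib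
          [symmetric]
      by (rule sum.cong) (auto simp: F_def eval_nat_numeral algebra_simps)
    also have "\<dots> = (\<Sum>d | d dvd n. 7 / 10 * real d ^ 5 - real d ^ 4 + 1 / 3 * real d ^ 3 - 1
        / 30 * real d
        - (real n / real d - 1) * F (real d) (- real d))"
      by (rule sum_quads_minus_divisors[OF _ _ _ S True]) (auto simp: F_def algebra_simps
          eval_nat_numeral)
    also have "\<dots> = (\<Sum>d | d dvd n. 7 / 10 * real d ^ 5 + 1 / 3 * real d ^ 3 - 1 / 30 * real d
        ^ 1 - real n * real d ^ 3)"
      by (rule sum.cong) (use divisor_pos[OF True] in \<open>auto simp: F_def field_simps
          eval_nat_numeral\<close>)
    also have "\<dots> = 7 / 10 * sigma_k 5 n + 1 / 3 * sigma_k 3 n - 1 / 30 * sigma_k 1 n - real n *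
        sigma_k 3 n"
      by (simp only: sigma_k_pos[OF True] sum.distrib sum_subtractf sum_distrib_left)
    finally show ?thesis
      by (simp add: numeral_fps_const lambert_nth mult.commute [of "lambert 3" "lambert 1"] ; simp add:
          algebra_simps)
  qed (simp_all add: power2_eq_square lambert_nth)
qed

text \<open>This is the classical \<open>E_4^2 = E_8\<close>. The derivative is absent because the
  factor \<open>a + b\<close> makes \<open>F d (- d)\<close> vanish.\<close>

lemma lambert_3_3: "120 * lambert 3 ^ 2 = lambert 7 - lambert 3"
proof (rule fps_ext)
  fix n
  define F where "F a b = (a * b * (a + b)) ^ 2" for a b :: real
  have S: "(\<Sum>a = 1..<d. F (real a) (real d - real a)) = 1 / 30 * real d ^ 7 - 1 / 30 * real d ^ 3"
    if "d > 0" for d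
  proof -
    obtain m where d: "d = Suc m" using \<open>d > 0\<close> gr0_implies_Suc by blast
    have "(\<Sum>a = 1..<d. F (real a) (real d - real a)) = (\<Sum>a = 1..<d. real d ^ 2 * real a ^ 4 -
        2 * real d ^ 3 * real a ^ 3 + real d ^ 4 * real a ^ 2)"
      by (rule sum.cong) (auto simp: F_def eval_nat_numeral algebra_simps)
    also have "\<dots> = real d ^ 2 * (\<Sum>a = 1..<d. real a ^ 4) - 2 * real d ^ 3 * (\<Sum>a =
        1..<d. real a ^ 3) + real d ^ 4 * (\<Sum>a = 1..<d. real a ^ 2)"
      by (simp add: sum.distrib sum_subtractf sum_distrib_left)
    also have "\<dots> = 1 / 30 * real d ^ 7 - 1 / 30 * real d ^ 3"
      unfolding d sum_powers by (simp add: field_simps eval_nat_numeral)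
    finally show ?thesis .
  qed
  show "(120 * lambert 3 ^ 2) $ n = (lambert 7 - lambert 3) $ n"
  proof (cases "n > 0")
    case True
    have "4 * (lambert 3 ^ 2) $ n = (\<Sum>(a, b, x, y) \<in> quads n. F (real a) (real b) - F (real a)
        (- real b))"
      unfolding power2_eq_square [of "lambert _"] lambert_mult_nth sum_distrib_left sum.distrib
          [symmetric]
      by (rule sum.cong) (auto simp: F_def eval_nat_numeral algebra_simps)
    also have "\<dots> = (\<Sum>d | d dvd n. 1 / 30 * real d ^ 7 - 1 / 30 * real d ^ 3
        - (real n / real d - 1) * F (real d) (- real d))"
      by (rule sum_quads_minus_divisors[OF _ _ _ S True]) (auto simp: F_def algebra_simps
          eval_nat_numeral)
    also have "\<dots> = (\<Sum>d | d dvd n. 1 / 30 * real d ^ 7 - 1 / 30 * real d ^ 3)"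
      by (rule sum.cong) (use divisor_pos[OF True] in \<open>auto simp: F_def field_simps
          eval_nat_numeral\<close>)
    also have "\<dots> = 1 / 30 * sigma_k 7 n - 1 / 30 * sigma_k 3 n"
      by (simp only: sigma_k_pos[OF True] sum.distrib sum_subtractf sum_distrib_left)
    finally show ?thesis
      by (simp add: numeral_fps_const lambert_nth ; simp add: algebra_simps)
  qed (simp_all add: power2_eq_square lambert_nth)
qed

lemma lambert_1_5: "5040 * (lambert 1 * lambert 5) + 5880 * lambert 3 ^ 2 = 249 * lambert 7 + 210 *
    lambert 5 - 49 * lambert 3 + 10 * lambert 1 - 420 * fps_XD (lambert 5)"
proof (rule fps_ext)
  fix n
  define F where "F a b = (a ^ 2 + a * b + b ^ 2) ^ 3" for a b :: real
  have S: "(\<Sum>a = 1..<d. F (real a) (real d - real a)) = 83 / 140 * real d ^ 7 - real d ^ 6 + 1 / 2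
      * real d ^ 5 - 7 / 60 * real d ^ 3 + 1 / 42 * real d"
    if "d > 0" for d
  proof -
    obtain m where d: "d = Suc m" using \<open>d > 0\<close> gr0_implies_Suc by blast
    have "(\<Sum>a = 1..<d. F (real a) (real d - real a)) = (\<Sum>a = 1..<d. real a ^ 6 - 3 * real d *
        real a ^ 5 + 6 * real d ^ 2 * real a ^ 4 - 7 * real d ^ 3 * real a ^ 3 + 6 * real d ^ 4 * real
        a ^ 2 - 3 * real d ^ 5 * real a + real d ^ 6)"
      by (rule sum.cong) (auto simp: F_def eval_nat_numeral algebra_simps)
    also have "\<dots> = (\<Sum>a = 1..<d. real a ^ 6) - 3 * real d * (\<Sum>a = 1..<d. real a ^ 5) + 6
        * real d ^ 2 * (\<Sum>a = 1..<d. real a ^ 4) - 7 * real d ^ 3 * (\<Sum>a = 1..<d. real a ^ 3) +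
        6 * real d ^ 4 * (\<Sum>a = 1..<d. real a ^ 2) - 3 * real d ^ 5 * (\<Sum>a = 1..<d. real a) +
        real (d - 1) * real d ^ 6"
      by (simp add: sum.distrib sum_subtractf sum_distrib_left)
    also have "\<dots> = 83 / 140 * real d ^ 7 - real d ^ 6 + 1 / 2 * real d ^ 5 - 7 / 60 * real d ^ 3
        + 1 / 42 * real d"
      unfolding d sum_powers by (simp add: field_simps eval_nat_numeral)
    finally show ?thesis .
  qed
  show "(5040 * (lambert 1 * lambert 5) + 5880 * lambert 3 ^ 2) $ n = (249 * lambert 7 + 210 * lambert
      5 - 49 * lambert 3 + 10 * lambert 1 - 420 * fps_XD (lambert 5)) $ n"
  proof (cases "n > 0")
    case True
    \<comment> \<open>\<open>F a b - F a (- b) = 6 * a ^ 5 * b + 6 * a * b ^ 5 + 14 * a ^ 3 * b ^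
      3\<close>; the last term brings in \<open>lambert 3 ^ 2\<close>.\<close>
    have "6 * (lambert 5 * lambert 1) $ n + 6 * (lambert 1 * lambert 5) $ n + 14 * (lambert 3 ^ 2) $ n
        = (\<Sum>(a, b, x, y) \<in> quads n. F (real a) (real b) - F (real a) (- real b))"
      unfolding power2_eq_square [of "lambert _"] lambert_mult_nth sum_distrib_left sum.distrib
          [symmetric]
      by (rule sum.cong) (auto simp: F_def eval_nat_numeral algebra_simps)
    also have "\<dots> = (\<Sum>d | d dvd n. 83 / 140 * real d ^ 7 - real d ^ 6 + 1 / 2 * real d ^ 5 -
        7 / 60 * real d ^ 3 + 1 / 42 * real d
        - (real n / real d - 1) * F (real d) (- real d))"
      by (rule sum_quads_minus_divisors[OF _ _ _ S True]) (auto simp: F_def algebra_simps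
          eval_nat_numeral)
    also have "\<dots> = (\<Sum>d | d dvd n. 83 / 140 * real d ^ 7 + 1 / 2 * real d ^ 5 - 7 / 60 * real
        d ^ 3 + 1 / 42 * real d ^ 1 - real n * real d ^ 5)"
      by (rule sum.cong) (use divisor_pos[OF True] in \<open>auto simp: F_def field_simps
          eval_nat_numeral\<close>)
    also have "\<dots> = 83 / 140 * sigma_k 7 n + 1 / 2 * sigma_k 5 n - 7 / 60 * sigma_k 3 n + 1 / 42 *
        sigma_k 1 n - real n * sigma_k 5 n"
      by (simp only: sigma_k_pos[OF True] sum.distrib sum_subtractf sum_distrib_left)
    finally show ?thesis
      by (simp add: numeral_fps_const lambert_nth mult.commute [of "lambert 5" "lambert 1"] ; simp add:
          algebra_simps)
  qed (simp_all add: power2_eq_square lambert_nth)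
qed

section \<open>Ramanujan's differential equations\<close>

lemma ramanujan_level_1:
  fixes P Q R :: "real fps"
  defines "P \<equiv> 1 - 24 * lambert 1" and "Q \<equiv> 1 + 240 * lambert 3" and "R \<equiv> 1 - 504
      * lambert 5"
  shows "12 * fps_XD P = P ^ 2 - Q" and "3 * fps_XD Q = P * Q - R" and "2 * fps_XD R = P * R - Q ^ 2"
proof -
  have XD: "fps_XD P = - 24 * fps_XD (lambert 1)" "fps_XD Q = 240 * fps_XD (lambert 3)"
    "fps_XD R = - 504 * fps_XD (lambert 5)"
    by (auto simp: fps_eq_iff P_def Q_def R_def numeral_fps_const)
  show "12 * fps_XD P = P ^ 2 - Q"
    unfolding XD unfolding P_def Q_def using lambert_1_1 by algebra
  show "3 * fps_XD Q = P * Q - R"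
    unfolding XD unfolding P_def Q_def R_def using lambert_1_3 by algebra
  \<comment> \<open>\<open>lambert 7\<close> is eliminated between the two convolutions; the factor
    5 keeps the multipliers integral.\<close>
  have "5 * (2 * fps_XD R) = 5 * (P * R - Q ^ 2)"
    unfolding XD unfolding P_def Q_def R_def using lambert_1_5 lambert_3_3 by algebra
  then show "2 * fps_XD R = P * R - Q ^ 2"
    by (metis mult_cancel_left zero_neq_numeral)
qed

section \<open>Dilation of power series and of Ramanujan's system\<close>

definition dilate :: "nat \<Rightarrow> real fps \<Rightarrow> real fps" where
  "dilate d F = fps_compose F (fps_X ^ d)"

lemma dilate_nth:
  assumes "d > 0"
  shows "dilate d F $ n = (if d dvd n then F $ (n div d) else 0)"
proof -
  have "dilate d F $ n = (\<Sum>i = 0..n. F $ i * (if n = d * i then 1 else 0))"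
    by (simp add: dilate_def fps_compose_nth fps_X_power_nth flip: power_mult)
  also have "\<dots> = (\<Sum>i \<in> {i \<in> {0..n}. n = d * i}. F $ i)"
    by (subst sum.inter_filter) (auto intro!: sum.cong)
  also have "{i \<in> {0..n}. n = d * i} = (if d dvd n then {n div d} else {})"
    using assms by (auto elim!: dvdE)
  finally show ?thesis by simp
qed

lemma dilate_mult: "d > 0 \<Longrightarrow> dilate d (F * G) = dilate d F * dilate d G"
  by (simp add: dilate_def fps_compose_mult_distrib)

lemma dilate_diff: "dilate d (F - G) = dilate d F - dilate d G"
  by (simp add: dilate_def fps_compose_sub_distrib)

lemma dilate_numeral_mult: "dilate d (numeral k * F) = numeral k * dilate d F"
  by (simp add: dilate_def numeral_fps_const fps_const_mult_apply_left)

lemma XD_dilate: "d > 0 \<Longrightarrow> fps_XD (dilate d F) = of_nat d * dilate d (fps_XD F)"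
  by (auto simp: fps_eq_iff dilate_nth fps_of_nat[symmetric] elim!: dvdE)

definition eis2 :: "nat \<Rightarrow> real fps" where
  "eis2 d = of_nat d * dilate d (1 - 24 * lambert 1)"

definition eis4 :: "nat \<Rightarrow> real fps" where
  "eis4 d = of_nat d ^ 2 * dilate d (1 + 240 * lambert 3)"

definition eis6 :: "nat \<Rightarrow> real fps" where
  "eis6 d = of_nat d ^ 3 * dilate d (1 - 504 * lambert 5)"

lemma XD_mult: "fps_XD (F * G) = fps_XD F * G + F * (fps_XD G :: real fps)"
  by (simp add: fps_XD_def algebra_simps)

lemma XD_of_nat [simp]: "fps_XD (of_nat k :: real fps) = 0"
  by (simp add: fps_XD_def)

lemma XD_of_nat_power_mult: "fps_XD (of_nat k ^ j * F) = of_nat k ^ j * fps_XD (F :: real fps)"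
  using XD_mult[of "of_nat (k ^ j)" F] XD_of_nat[of "k ^ j"] by simp

text \<open>The chain rule produces one factor \<open>d\<close>. Scaling \<open>P\<close>,
  \<open>Q\<close>, \<open>R\<close> by \<open>d\<close>, \<open>d ^ 2\<close>, \<open>d ^ 3\<close>
  gives every term of an equation the same power of \<open>d\<close>.\<close>

lemma ramanujan_dilate:
  assumes "d > 0" and "12 * fps_XD P = P ^ 2 - Q" and "3 * fps_XD Q = P * Q - R"
    and "2 * fps_XD R = P * R - Q ^ 2"
  shows "12 * fps_XD (of_nat d * dilate d P) = (of_nat d * dilate d P) ^ 2 - of_nat d ^ 2 * dilate d Q"
    and "3 * fps_XD (of_nat d ^ 2 * dilate d Q)
      = (of_nat d * dilate d P) * (of_nat d ^ 2 * dilate d Q) - of_nat d ^ 3 * dilate d R"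
    and "2 * fps_XD (of_nat d ^ 3 * dilate d R)
      = (of_nat d * dilate d P) * (of_nat d ^ 3 * dilate d R) - (of_nat d ^ 2 * dilate d Q) ^ 2"
proof -
  note dil = assms(2-4)[THEN arg_cong[where f = "dilate d"],
      unfolded dilate_numeral_mult dilate_diff dilate_mult[OF assms(1)] power2_eq_square]
  have XD: "fps_XD (of_nat d ^ j * dilate d F) = of_nat d ^ j * (of_nat d * dilate d (fps_XD F))" for j
      F
    using XD_of_nat_power_mult[of d j] XD_dilate[OF assms(1)] by simp
  show "12 * fps_XD (of_nat d * dilate d P) = (of_nat d * dilate d P) ^ 2 - of_nat d ^ 2 * dilate d Q"
    using XD[of 1 P] dil(1) by (simp only: power_one_right) algebra
  show "3 * fps_XD (of_nat d ^ 2 * dilate d Q)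
      = (of_nat d * dilate d P) * (of_nat d ^ 2 * dilate d Q) - of_nat d ^ 3 * dilate d R"
    using XD[of 2 Q] dil(2) by algebra
  show "2 * fps_XD (of_nat d ^ 3 * dilate d R)
      = (of_nat d * dilate d P) * (of_nat d ^ 3 * dilate d R) - (of_nat d ^ 2 * dilate d Q) ^ 2"
    using XD[of 3 R] dil(3) by algebra
qed

lemma ramanujan:
  assumes "d > 0"
  shows "12 * fps_XD (eis2 d) = eis2 d ^ 2 - eis4 d"
    and "3 * fps_XD (eis4 d) = eis2 d * eis4 d - eis6 d"
    and "2 * fps_XD (eis6 d) = eis2 d * eis6 d - eis4 d ^ 2"
  unfolding eis2_def eis4_def eis6_def
  by (rule ramanujan_dilate[OF assms ramanujan_level_1])+

section \<open>Eta products\<close>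

text \<open>Congruence modulo \<open>q^(N + 1)\<close>, by which truncated products stand in for
  infinite ones.\<close>

definition eq_upto :: "nat \<Rightarrow> real fps \<Rightarrow> real fps \<Rightarrow> bool" where
  "eq_upto N F G \<longleftrightarrow> (\<forall>n\<le>N. F $ n = G $ n)"

lemma eq_upto_refl: "eq_upto N F F"
  by (simp add: eq_upto_def)

lemma eq_upto_mult: "eq_upto N F F' \<Longrightarrow> eq_upto N G G' \<Longrightarrow> eq_upto N (F *
    G) (F' * G')"
  by (auto simp: eq_upto_def fps_mult_nth intro!: sum.cong)

lemma eq_upto_power: "eq_upto N F F' \<Longrightarrow> eq_upto N (F ^ k) (F' ^ k)"
  by (induction k) (auto intro: eq_upto_mult eq_upto_refl)

text \<open>Multiply the congruence of \<open>F\<close> and \<open>G\<close> by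
  \<open>inverse F * inverse G\<close>.\<close>

lemma eq_upto_inverse:
  assumes "eq_upto N F G" and "F $ 0 \<noteq> 0"
  shows "eq_upto N (inverse F) (inverse G)"
proof -
  have G0: "G $ 0 \<noteq> 0" using assms by (auto simp: eq_upto_def)
  have "eq_upto N (inverse F * inverse G * G) (inverse F * inverse G * F)"
    using assms(1) by (intro eq_upto_mult eq_upto_refl) (simp add: eq_upto_def)
  moreover have "inverse F * inverse G * G = inverse F"
    using inverse_mult_eq_1[OF G0] by (simp add: mult.assoc)
  moreover have "inverse F * inverse G * F = inverse G"
    using inverse_mult_eq_1[OF assms(2)] by (simp add: mult_ac)
  ultimately show ?thesis by simp
qed

text \<open>This is \<open>\<eta>(d z)\<close> without its factor \<open>q^(d/24)\<close>. The
  diagonal choice works because coefficient \<open>n\<close> no longer changes after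
  \<open>n\<close> factors.\<close>

definition eta :: "nat \<Rightarrow> real fps" where
  "eta d = Abs_fps (\<lambda>n. eta_trunc d n $ n)"

lemma eta_trunc_Suc: "eta_trunc d (Suc N) = eta_trunc d N * (1 - fps_X ^ (d * Suc N))"
  by (simp add: eta_trunc_def prod.nat_ivl_Suc' mult.commute)

lemma eta_trunc_eq_upto:
  assumes "d > 0"
  shows "eq_upto N (eta_trunc d N) (eta d)"
proof -
  have "eta_trunc d (n + k) $ n = eta_trunc d n $ n" for n k
  proof (induction k)
    case (Suc k)
    have "n < d * Suc (n + k)"
      using mult_le_mono1[of 1 d "Suc (n + k)"] assms by simp
    with Suc show ?case
      by (simp add: eta_trunc_Suc right_diff_distrib fps_X_power_mult_right_nth)
  qed simp
  then show ?thesis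
    by (auto simp: eq_upto_def eta_def) (metis le_add_diff_inverse)
qed

lemma eta_0 [simp]: "eta d $ 0 = 1"
  by (simp add: eta_def eta_trunc_def)

lemma eta_trunc_0 [simp]: "d > 0 \<Longrightarrow> eta_trunc d N $ 0 = 1"
  using eta_trunc_eq_upto[of d N] by (simp add: eq_upto_def)

text \<open>The logarithmic derivative of \<open>1 - q^m\<close> is
  \<open>- m (q^m + q^(2m) + ...)\<close>, and logarithmic derivatives of factors add.\<close>

lemma XD_eta_trunc:
  assumes "d > 0"
  shows "fps_XD (eta_trunc d N)
    = eta_trunc d N * (\<Sum>k = 1..N. Abs_fps (\<lambda>n. if n > 0 \<and> d * k dvd n then - real (d
        * k) else 0))"
proof (induction N)
  case 0
  show ?case by (simp add: eta_trunc_def fps_XD_def)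
next
  case (Suc N)
  define m where "m = d * Suc N"
  have "m > 0" using assms by (simp add: m_def)
  define g where "g = Abs_fps (\<lambda>n. if n > 0 \<and> m dvd n then - real m else 0)"
  have XD: "fps_XD (1 - fps_X ^ m) = (1 - fps_X ^ m) * g"
  proof (rule fps_ext)
    fix n
    show "fps_XD (1 - fps_X ^ m) $ n = ((1 - fps_X ^ m) * g) $ n"
      using \<open>m > 0\<close> by (auto simp: g_def left_diff_distrib fps_X_power_mult_nth
          fps_X_power_nth
        dvd_minus_self dest: dvd_imp_le)
  qed
  have sum: "(\<Sum>k = 1..Suc N. Abs_fps (\<lambda>n. if n > 0 \<and> d * k dvd n then - real (d * k)
      else 0))
      = (\<Sum>k = 1..N. Abs_fps (\<lambda>n. if n > 0 \<and> d * k dvd n then - real (d * k) else 0))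
          + g"
    unfolding g_def m_def by simp
  show ?case
    unfolding eta_trunc_Suc XD_mult m_def[symmetric] Suc XD sum by (simp only: distrib_left mult_ac)
qed

text \<open>At \<open>n = d m\<close> the logarithmic derivatives of the factors add up to
  \<open>- d \<sigma>(m)\<close>. The constant \<open>- of_nat d\<close> accounts for the omitted
  \<open>q^(d/24)\<close>.\<close>

lemma XD_eta:
  assumes "d > 0"
  shows "24 * fps_XD (eta d) = eta d * (eis2 d - of_nat d)"
proof (rule fps_ext)
  fix N
  define G where "G = (\<Sum>k = 1..N. Abs_fps (\<lambda>n. if n > 0 \<and> d * k dvd n then - real (d
      * k) else 0))"
  have "24 * G $ n = (eis2 d - of_nat d) $ n" if "n \<le> N" for n
  proof (cases "n > 0 \<and> d dvd n")
    case True
    then obtain m where m: "n = d * m" by auto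
    with True have "m > 0" by auto
    have "G $ n = (\<Sum>k = 1..N. if k dvd m then - real (d * k) else 0)"
      using True assms by (simp add: G_def fps_sum_nth m)
    also have "\<dots> = (\<Sum>k \<in> {k. k dvd m}. - real (d * k))"
    proof (rule sum.mono_neutral_cong_right)
      show "{k. k dvd m} \<subseteq> {1..N}"
      proof
        fix k assume "k \<in> {k. k dvd m}"
        then have "k \<le> m" "k > 0" using \<open>m > 0\<close> by (auto dest: dvd_imp_le intro:
            Nat.gr0I)
        moreover have "m \<le> n" using assms m by (cases d) auto
        ultimately show "k \<in> {1..N}" using that by auto
      qed
    qed auto
    also have "\<dots> = - real d * sigma_k 1 m"
      using \<open>m > 0\<close> by (simp add: sigma_k_pos sum_distrib_left sum_negf)
    finally show ?thesis using \<open>m > 0\<close> assms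
      by (simp add: eis2_def dilate_nth lambert_nth m numeral_fps_const fps_of_nat[symmetric])
  next
    case False
    have "G $ n = 0"
      using False by (auto simp: G_def fps_sum_nth intro!: sum.neutral dest: dvd_mult_left)
    then show ?thesis using False assms
      by (cases "n = 0") (auto simp: eis2_def dilate_nth lambert_nth numeral_fps_const
          fps_of_nat[symmetric])
  qed
  then have G: "eq_upto N (24 * G) (eis2 d - of_nat d)"
    by (simp add: eq_upto_def numeral_fps_const)
  \<comment> \<open>Coefficient \<open>N\<close> sees only the truncation at \<open>N\<close>, to
    which the finite product rule applies.\<close>
  have "(24 * fps_XD (eta d)) $ N = (24 * fps_XD (eta_trunc d N)) $ N"
    using eta_trunc_eq_upto[OF assms, of N] by (simp add: eq_upto_def numeral_fps_const)
  also have "24 * fps_XD (eta_trunc d N) = eta_trunc d N * (24 * G)"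
    by (simp add: XD_eta_trunc[OF assms] G_def)
  also have "eq_upto N \<dots> (eta d * (eis2 d - of_nat d))"
    by (intro eq_upto_mult G eta_trunc_eq_upto assms)
  then have "(eta_trunc d N * (24 * G)) $ N = (eta d * (eis2 d - of_nat d)) $ N"
    by (simp add: eq_upto_def)
  finally show "(24 * fps_XD (eta d)) $ N = (eta d * (eis2 d - of_nat d)) $ N" .
qed

section \<open>Weight 2, 4 and 6 forms of level 14\<close>

text \<open>If \<open>\<theta> = q d/dq\<close> acts by \<open>\<theta> a = a (Z + T)\<close>,
  \<open>\<theta> b = b (Z - T)\<close>, \<open>\<theta> c = c (Z + S)\<close>,
  \<open>\<theta> e = e (Z - S)\<close>, \<open>\<theta> f = f Z\<close>, then a form
  \<open>p\<close> of degree \<open>k\<close> satisfies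
  \<open>\<theta> p = k Z p + T p_t + S p_s\<close> with the suffixes below. The form
  \<open>lin\<close> was found by comparing coefficients of \<open>eis2 1 - 6 Z\<close>, and
  \<open>quad0\<close>, which is \<open>-72\<close> times
  \<open>\<theta> Z - Z\<^sup>2/2\<close>, likewise; Ramanujan's equations then force
  \<open>quad\<close> and \<open>cub\<close>.\<close>

definition lin :: "'a::idom \<Rightarrow> 'a \<Rightarrow> 'a \<Rightarrow> 'a \<Rightarrow> 'a
    \<Rightarrow> 'a" where
  "lin a b c e f =
    - 3 * a - 6 * b + 2 * c - 2 * e - 24 * f"

text \<open>In the forms with suffix \<open>_t\<close> each monomial is multiplied by its degree in
  \<open>a\<close> minus its degree in \<open>b\<close>; suffix \<open>_s\<close> does the same with
  \<open>c\<close> and \<open>e\<close>.\<close>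

definition lin_t :: "'a::idom \<Rightarrow> 'a \<Rightarrow> 'a \<Rightarrow> 'a \<Rightarrow> 'a
    \<Rightarrow> 'a" where
  "lin_t a b c e f =
    - 3 * a + 6 * b"

definition lin_s :: "'a::idom \<Rightarrow> 'a \<Rightarrow> 'a \<Rightarrow> 'a \<Rightarrow> 'a
    \<Rightarrow> 'a" where
  "lin_s a b c e f =
    2 * c + 2 * e"

definition quad :: "'a::idom \<Rightarrow> 'a \<Rightarrow> 'a \<Rightarrow> 'a \<Rightarrow> 'a
    \<Rightarrow> 'a" where
  "quad a b c e f =
    45 * a ^ 2 + 36 * a * b - 48 * a * e + 432 * a * f + 72 * b ^ 2 - 72 * b * c + 120 * b * e
    + 576 * b * f + 4 * c ^ 2 - 8 * c * e - 96 * c * f + 4 * e ^ 2 + 96 * e * f + 1548 * f ^ 2"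

definition quad_t :: "'a::idom \<Rightarrow> 'a \<Rightarrow> 'a \<Rightarrow> 'a \<Rightarrow> 'a
    \<Rightarrow> 'a" where
  "quad_t a b c e f =
    90 * a ^ 2 - 48 * a * e + 432 * a * f - 144 * b ^ 2 + 72 * b * c - 120 * b * e
    - 576 * b * f"

definition quad_s :: "'a::idom \<Rightarrow> 'a \<Rightarrow> 'a \<Rightarrow> 'a \<Rightarrow> 'a
    \<Rightarrow> 'a" where
  "quad_s a b c e f =
    48 * a * e - 72 * b * c - 120 * b * e + 8 * c ^ 2 - 96 * c * f - 8 * e ^ 2 - 96 * e * f"

definition cub :: "'a::idom \<Rightarrow> 'a \<Rightarrow> 'a \<Rightarrow> 'a \<Rightarrow> 'a
    \<Rightarrow> 'a" where
  "cub a b c e f =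
    - 135 * a ^ 3 - 378 * a ^ 2 * b - 180 * a ^ 2 * c + 180 * a ^ 2 * e - 2376 * a ^ 2 * f
    - 432 * a * b ^ 2 + 504 * a * b * c + 360 * a * b * e - 5184 * a * b * f - 36 * a * c ^ 2
    + 72 * a * c * e + 144 * a * c * f - 36 * a * e ^ 2 + 1584 * a * e * f - 15012 * a * f ^ 2
    - 432 * b ^ 3 + 792 * b ^ 2 * c - 1656 * b ^ 2 * e - 5184 * b ^ 2 * f - 360 * b * c ^ 2
    + 1008 * b * c * e + 4896 * b * c * f - 648 * b * e ^ 2 - 6624 * b * e * f
    - 23112 * b * f ^ 2 + 8 * c ^ 3 - 24 * c ^ 2 * e - 288 * c ^ 2 * f + 24 * c * e ^ 2
    + 576 * c * e * f + 5400 * c * f ^ 2 - 8 * e ^ 3 - 288 * e ^ 2 * f - 5400 * e * f ^ 2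
    - 37152 * f ^ 3"

definition cub_t :: "'a::idom \<Rightarrow> 'a \<Rightarrow> 'a \<Rightarrow> 'a \<Rightarrow> 'a
    \<Rightarrow> 'a" where
  "cub_t a b c e f =
    - 405 * a ^ 3 - 378 * a ^ 2 * b - 360 * a ^ 2 * c + 360 * a ^ 2 * e - 4752 * a ^ 2 * f
    + 432 * a * b ^ 2 - 36 * a * c ^ 2 + 72 * a * c * e + 144 * a * c * f - 36 * a * e ^ 2
    + 1584 * a * e * f - 15012 * a * f ^ 2 + 1296 * b ^ 3 - 1584 * b ^ 2 * c + 3312 * b ^ 2 * e
    + 10368 * b ^ 2 * f + 360 * b * c ^ 2 - 1008 * b * c * e - 4896 * b * c * f
    + 648 * b * e ^ 2 + 6624 * b * e * f + 23112 * b * f ^ 2"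

definition cub_s :: "'a::idom \<Rightarrow> 'a \<Rightarrow> 'a \<Rightarrow> 'a \<Rightarrow> 'a
    \<Rightarrow> 'a" where
  "cub_s a b c e f =
    - 180 * a ^ 2 * c - 180 * a ^ 2 * e + 504 * a * b * c - 360 * a * b * e - 72 * a * c ^ 2
    + 144 * a * c * f + 72 * a * e ^ 2 - 1584 * a * e * f + 792 * b ^ 2 * c + 1656 * b ^ 2 * e
    - 720 * b * c ^ 2 + 4896 * b * c * f + 1296 * b * e ^ 2 + 6624 * b * e * f + 24 * c ^ 3
    - 24 * c ^ 2 * e - 576 * c ^ 2 * f - 24 * c * e ^ 2 + 5400 * c * f ^ 2 + 24 * e ^ 3
    + 576 * e ^ 2 * f + 5400 * e * f ^ 2"

text \<open>Cofactor of the defect \<open>c + e - a - b - 7 * f\<close> in Ramanujan's third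
  equation modulo the two product relations; it couples \<open>err_r\<close> into the equations for
  \<open>err_w\<close>.\<close>

definition cub_r :: "'a::idom \<Rightarrow> 'a \<Rightarrow> 'a \<Rightarrow> 'a \<Rightarrow> 'a
    \<Rightarrow> 'a" where
  "cub_r a b c e f =
    1620 * a ^ 3 + 1188 * a ^ 2 * b + 180 * a ^ 2 * c - 1980 * a ^ 2 * e + 17172 * a ^ 2 * f
    + 14256 * a * b ^ 2 + 432 * a * b * c + 12312 * a * b * e + 64800 * a * b * f
    - 72 * a * c ^ 2 - 1152 * a * c * e - 1080 * a * c * f + 360 * a * e ^ 2 + 8856 * a * e * f
    + 91152 * a * f ^ 2 + 2592 * b ^ 3 - 1152 * b ^ 2 * c + 3168 * b ^ 2 * e
    + 23328 * b ^ 2 * f - 864 * b * c ^ 2 - 6048 * b * c * e + 4320 * b * c * f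
    + 1728 * b * e ^ 2 + 29376 * b * e * f + 14256 * b * f ^ 2 + 11664 * c * f ^ 2
    - 3888 * e * f ^ 2 - 120528 * f ^ 3"

definition quad0 :: "'a::idom \<Rightarrow> 'a \<Rightarrow> 'a \<Rightarrow> 'a \<Rightarrow> 'a
    \<Rightarrow> 'a" where
  "quad0 a b c e f =
    36 * a ^ 2 + 288 * a * f + 36 * b ^ 2 + 288 * b * f + 972 * f ^ 2"

lemmas form_defs = lin_def lin_t_def lin_s_def quad_def quad_t_def quad_s_def cub_def cub_t_def
    cub_s_def
  cub_r_def quad0_def

text \<open>Ramanujan's first equation for \<open>6 Z + lin\<close>, with \<open>T = c - e\<close>,
  \<open>S = a - b\<close> and \<open>72 \<theta> Z = 36 Z^2 - quad0\<close>; all terms in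
  \<open>Z\<close> cancel.\<close>

lemma quad_eq:
  "quad a b c e f = lin a b c e f ^ 2 - 12 * (lin_t a b c e f * (c - e) + lin_s a b c e f * (a - b))
     + quad0 a b c e f"
  unfolding form_defs by algebra

text \<open>Ramanujan's second equation for \<open>6 Z + lin\<close> and \<open>quad\<close>, again
  after the terms in \<open>Z\<close> cancel.\<close>

lemma cub_eq:
  "cub a b c e f = lin a b c e f * quad a b c e f
     - 3 * (quad_t a b c e f * (c - e) + quad_s a b c e f * (a - b))"
  unfolding form_defs by algebra

text \<open>Ramanujan's third equation holds on the curve \<open>a b = 8 f\<^sup>2\<close>,
  \<open>c e = f\<^sup>2\<close>, \<open>c + e = a + b + 7 f\<close>. The last relation is
  not known yet, so its defect is kept.\<close>
lemma cub_closed: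
  assumes "a * b = 8 * f ^ 2" and "c * e = f ^ 2"
  shows "lin a b c e f * cub a b c e f - quad a b c e f ^ 2
      - 2 * (cub_t a b c e f * (c - e) + cub_s a b c e f * (a - b))
    = cub_r a b c e f * (c + e - a - b - 7 * f)"
  unfolding form_defs using assms by algebra

lemma XD_simps:
  "fps_XD (F - G) = fps_XD F - fps_XD (G :: real fps)" "fps_XD (- F) = - fps_XD F"
  "fps_XD (numeral k) = (0 :: real fps)"
  by (auto simp: fps_eq_iff numeral_fps_const algebra_simps)

lemma XD_power: "fps_XD (F ^ Suc k) = of_nat (Suc k) * F ^ k * fps_XD (F :: real fps)"
  by (induction k) (simp_all add: XD_mult algebra_simps)

lemma XD_power2: "fps_XD (F ^ 2) = 2 * F * fps_XD (F :: real fps)"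
  using XD_power[of F 1] by (simp add: numeral_2_eq_2)

lemma XD_power3: "fps_XD (F ^ 3) = 3 * F ^ 2 * fps_XD (F :: real fps)"
  using XD_power[of F 2] by (simp add: eval_nat_numeral)

lemma XD_forms:
  fixes a b c e f Z T S :: "real fps"
  assumes "fps_XD a = a * (Z + T)" "fps_XD b = b * (Z - T)" "fps_XD c = c * (Z + S)"
    "fps_XD e = e * (Z - S)" "fps_XD f = f * Z"
  shows "fps_XD (lin a b c e f) = Z * lin a b c e f + T * lin_t a b c e f + S * lin_s a b c e f"
    and "fps_XD (quad a b c e f) = 2 * Z * quad a b c e f + T * quad_t a b c e f + S * quad_s a b c e f"
    and "fps_XD (cub a b c e f) = 3 * Z * cub a b c e f + T * cub_t a b c e f + S * cub_s a b c e f"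
  unfolding form_defs fps_XD_add XD_simps XD_mult XD_power2 XD_power3 assms by algebra+

text \<open>Subtracting the derivatives of the conjectured forms from Ramanujan's equations leaves
  only terms with an error factor: the rest cancels by \<open>quad_eq\<close>, \<open>cub_eq\<close>
  and \<open>cub_closed\<close>. The series stay abstract so that one computation serves all four
  \<open>d\<close>.\<close>

lemma error_equations:
  fixes a b c e f Z T S X Y W :: "real fps"
  assumes XD: "fps_XD a = a * (Z + T)" "fps_XD b = b * (Z - T)" "fps_XD c = c * (Z + S)"
    "fps_XD e = e * (Z - S)" "fps_XD f = f * Z"
    and prods: "a * b = 8 * f ^ 2" "c * e = f ^ 2"
    and ram: "12 * fps_XD X = X ^ 2 - Y" "3 * fps_XD Y = X * Y - W" "2 * fps_XD W = X * W - Y ^ 2"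
    and Z: "288 * fps_XD Z = 144 * Z ^ 2 - 4 * quad0 a b c e f + \<zeta>"
    and x: "x = X - 6 * Z - lin a b c e f" and y: "y = Y - quad a b c e f" and w: "w = W - cub a b c e
        f"
    and t: "t = T - (c - e)" and s: "s = S - (a - b)" and r: "r = c + e - a - b - 7 * f"
  shows "48 * fps_XD x = 48 * Z * x + 8 * lin a b c e f * x + 4 * x * x - 4 * y - \<zeta>
      - 48 * lin_t a b c e f * t - 48 * lin_s a b c e f * s"
    and "3 * fps_XD y = 6 * Z * y + lin a b c e f * y + Y * x - w
      - 3 * quad_t a b c e f * t - 3 * quad_s a b c e f * s"
    and "2 * fps_XD w = 6 * Z * w + lin a b c e f * w + W * x - (Y + quad a b c e f) * y
      + cub_r a b c e f * r - 2 * cub_t a b c e f * t - 2 * cub_s a b c e f * s"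
proof -
  note forms = XD_forms[OF XD]
  have "48 * fps_XD x = 4 * (12 * fps_XD X) - 288 * fps_XD Z - 48 * fps_XD (lin a b c e f)"
    by (simp add: x XD_simps XD_mult algebra_simps)
  also have "\<dots> = 48 * Z * x + 8 * lin a b c e f * x + 4 * x * x - 4 * y - \<zeta>
      - 48 * lin_t a b c e f * t - 48 * lin_s a b c e f * s"
    unfolding Z ram forms x y t s using quad_eq[of a b c e f] by algebra
  finally show "48 * fps_XD x = 48 * Z * x + 8 * lin a b c e f * x + 4 * x * x - 4 * y - \<zeta>
      - 48 * lin_t a b c e f * t - 48 * lin_s a b c e f * s" .
  have "3 * fps_XD y = 3 * fps_XD Y - 3 * fps_XD (quad a b c e f)"
    by (simp add: y XD_simps algebra_simps)
  also have "\<dots> = 6 * Z * y + lin a b c e f * y + Y * x - w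
      - 3 * quad_t a b c e f * t - 3 * quad_s a b c e f * s"
    unfolding ram forms x y w t s using cub_eq[of a b c e f] by algebra
  finally show "3 * fps_XD y = 6 * Z * y + lin a b c e f * y + Y * x - w
      - 3 * quad_t a b c e f * t - 3 * quad_s a b c e f * s" .
  have "2 * fps_XD w = 2 * fps_XD W - 2 * fps_XD (cub a b c e f)"
    by (simp add: w XD_simps algebra_simps)
  also have "\<dots> = 6 * Z * w + lin a b c e f * w + W * x - (Y + quad a b c e f) * y
      + cub_r a b c e f * r - 2 * cub_t a b c e f * t - 2 * cub_s a b c e f * s"
    unfolding ram forms x y w t s r using cub_closed[OF prods] by algebra
  finally show "2 * fps_XD w = 6 * Z * w + lin a b c e f * w + W * x - (Y + quad a b c e f) * y
      + cub_r a b c e f * r - 2 * cub_t a b c e f * t - 2 * cub_s a b c e f * s" .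
qed

section \<open>Logarithmic derivatives of the eta quotients\<close>

definition log_deriv :: "real fps \<Rightarrow> real fps \<Rightarrow> bool" where
  "log_deriv F L \<longleftrightarrow> 24 * fps_XD F = F * L"

lemma log_deriv_mult: "log_deriv F L \<Longrightarrow> log_deriv G M \<Longrightarrow> log_deriv (F *
    G) (L + M)"
  unfolding log_deriv_def XD_mult by algebra

lemma log_deriv_power: "log_deriv F L \<Longrightarrow> log_deriv (F ^ k) (of_nat k * L)"
proof (induction k)
  case 0
  show ?case by (simp add: log_deriv_def fps_XD_def)
next
  case (Suc k)
  from log_deriv_mult[OF Suc.prems Suc.IH[OF Suc.prems]] show ?case
    by (simp add: algebra_simps)
qed

lemma log_deriv_inverse:
  assumes "F $ 0 \<noteq> 0" "log_deriv F L"
  shows "log_deriv (inverse F) (- L)"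
proof -
  have FF: "inverse F * F = 1" by (rule inverse_mult_eq_1[OF assms(1)])
  have "fps_XD (inverse F * F) = 0" unfolding FF by (simp add: fps_XD_def)
  then have "F * (24 * fps_XD (inverse F)) = F * (inverse F * - L)"
    unfolding XD_mult using assms(2)[unfolded log_deriv_def] by algebra
  moreover have "F \<noteq> 0" using assms(1) by auto
  ultimately show ?thesis by (metis log_deriv_def mult_cancel_left)
qed

lemma log_deriv_X: "log_deriv fps_X 24"
  by (simp add: log_deriv_def fps_XD_def)

lemma log_deriv_numeral: "log_deriv (numeral k) 0"
  by (simp add: log_deriv_def XD_simps)

lemma log_deriv_eta: "d > 0 \<Longrightarrow> log_deriv (eta d) (eis2 d - of_nat d)"
  by (simp add: log_deriv_def XD_eta)

lemma log_deriv_inverse_eta: "d > 0 \<Longrightarrow> log_deriv (inverse (eta d)) (- (eis2 d - of_nat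
    d))"
  by (rule log_deriv_inverse) (simp_all add: log_deriv_eta)

text \<open>The powers of \<open>fps_X\<close> collect the factors \<open>q^(d/24)\<close>; the
  exponents are 0, 2, 2, 0, 1 for \<open>qa\<close>, \<open>qb\<close>, \<open>qc\<close>,
  \<open>qe\<close>, \<open>qf\<close>. The constant 8 in \<open>qb\<close> lets the substitution
  for \<open>d = 2\<close> exchange \<open>qa\<close> and \<open>qb\<close> without a
  scalar.\<close>

definition qa :: "real fps" where
  "qa = eta 1 ^ 4 * eta 7 ^ 4 * inverse (eta 2) ^ 2 * inverse (eta 14) ^ 2"

definition qb :: "real fps" where
  "qb = 8 * fps_X ^ 2 * eta 2 ^ 4 * eta 14 ^ 4 * inverse (eta 1) ^ 2 * inverse (eta 7) ^ 2"

definition qc :: "real fps" where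
  "qc = fps_X ^ 2 * eta 1 ^ 5 * eta 14 ^ 5 * inverse (eta 2) ^ 3 * inverse (eta 7) ^ 3"

definition qe :: "real fps" where
  "qe = eta 2 ^ 5 * eta 7 ^ 5 * inverse (eta 1) ^ 3 * inverse (eta 14) ^ 3"

definition qf :: "real fps" where
  "qf = fps_X * eta 1 * eta 2 * eta 7 * eta 14"

text \<open>\<open>qZ\<close> is the logarithmic derivative of \<open>qf\<close>. Since
  \<open>qa * qb\<close> and \<open>qc * qe\<close> are multiples of \<open>qf ^ 2\<close>, the
  logarithmic derivatives in each pair lie symmetrically about \<open>qZ\<close>, at distance
  \<open>qT\<close> and \<open>qS\<close>.\<close>

definition qZ :: "real fps" where
  "qZ = fps_const (1 / 24) * (eis2 1 + eis2 2 + eis2 7 + eis2 14)"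

definition qT :: "real fps" where
  "qT = fps_const (1 / 8) * (eis2 1 - eis2 2 + eis2 7 - eis2 14)"

definition qS :: "real fps" where
  "qS = fps_const (1 / 6) * (eis2 1 - eis2 2 - eis2 7 + eis2 14)"

lemma qZ_eq: "24 * qZ = eis2 1 + eis2 2 + eis2 7 + eis2 14"
  and qT_eq: "8 * qT = eis2 1 - eis2 2 + eis2 7 - eis2 14"
  and qS_eq: "6 * qS = eis2 1 - eis2 2 - eis2 7 + eis2 14"
  by (simp_all add: qZ_def qT_def qS_def numeral_fps_const mult.assoc[symmetric])

lemma inverse_eta: "inverse (eta d) * eta d = 1"
  by (rule inverse_mult_eq_1) simp

lemma q_products: "qa * qb = 8 * qf ^ 2" "qc * qe = qf ^ 2"
  unfolding qa_def qb_def qc_def qe_def qf_def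
  using inverse_eta[of 1] inverse_eta[of 2] inverse_eta[of 7] inverse_eta[of 14] by algebra+

lemmas log_deriv_intros = log_deriv_mult log_deriv_power log_deriv_inverse_eta log_deriv_eta
  log_deriv_X log_deriv_numeral

text \<open>The constants \<open>- of_nat d\<close> of the eta factors cancel against the 24
  contributed by each \<open>fps_X\<close>.\<close>

lemma XD_q:
  "fps_XD qa = qa * (qZ + qT)" "fps_XD qb = qb * (qZ - qT)" "fps_XD qc = qc * (qZ + qS)"
  "fps_XD qe = qe * (qZ - qS)" "fps_XD qf = qf * qZ"
proof -
  have *: "fps_XD F = F * M" if "log_deriv F L" "L = 24 * M" for F L M
    using that by (simp add: log_deriv_def)
  note eqs = qZ_eq[simplified] qT_eq[simplified] qS_eq[simplified]
  show "fps_XD qa = qa * (qZ + qT)"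
    unfolding qa_def
    by (rule *, (rule log_deriv_intros; simp?)+, simp) (use eqs in algebra)
  show "fps_XD qb = qb * (qZ - qT)"
    unfolding qb_def
    by (rule *, (rule log_deriv_intros; simp?)+, simp) (use eqs in algebra)
  show "fps_XD qc = qc * (qZ + qS)"
    unfolding qc_def
    by (rule *, (rule log_deriv_intros; simp?)+, simp) (use eqs in algebra)
  show "fps_XD qe = qe * (qZ - qS)"
    unfolding qe_def
    by (rule *, (rule log_deriv_intros; simp?)+, simp) (use eqs in algebra)
  show "fps_XD qf = qf * qZ"
    unfolding qf_def
    by (rule *, (rule log_deriv_intros; simp?)+, simp) (use eqs in algebra)
qed

section \<open>The errors satisfy a linear system\<close>

text \<open>The substitutions are the Atkin--Lehner involutions of level 14: they carry
  \<open>eis2 1\<close> to \<open>eis2 d\<close> and change the signs of \<open>qT\<close>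
  and \<open>qS\<close> accordingly.\<close>
definition at_cusp :: "nat \<Rightarrow> (real fps \<Rightarrow> real fps \<Rightarrow> real fps
    \<Rightarrow> real fps \<Rightarrow> real fps \<Rightarrow> real fps) \<Rightarrow> real fps" where
  "at_cusp d p = (if d = 1 then p qa qb qc qe qf else if d = 2 then p qb qa qe qc qf
     else if d = 7 then p (- qa) (- qb) (- qe) (- qc) (- qf) else p (- qb) (- qa) (- qc) (- qe) (- qf))"

lemma at_cusp_simps:
  "at_cusp 1 p = p qa qb qc qe qf"
  "at_cusp 2 p = p qb qa qe qc qf"
  "at_cusp 7 p = p (- qa) (- qb) (- qe) (- qc) (- qf)"
  "at_cusp 14 p = p (- qb) (- qa) (- qc) (- qe) (- qf)"
  by (simp_all add: at_cusp_def)

text \<open>The part \<open>6 * qZ\<close> is common to all \<open>d\<close>: \<open>24 * qZ\<close>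
  is the sum of the four \<open>eis2 d\<close>, and the four linear forms add up to zero.\<close>

definition err_x :: "nat \<Rightarrow> real fps" where
  "err_x d = eis2 d - 6 * qZ - at_cusp d lin"

definition err_y :: "nat \<Rightarrow> real fps" where
  "err_y d = eis4 d - at_cusp d quad"

definition err_w :: "nat \<Rightarrow> real fps" where
  "err_w d = eis6 d - at_cusp d cub"

definition err_r :: "real fps" where
  "err_r = qc + qe - qa - qb - 7 * qf"

definition err_t :: "real fps" where
  "err_t = qT - (qc - qe)"

definition err_s :: "real fps" where
  "err_s = qS - (qa - qb)"

definition err_z :: "real fps" where
  "err_z = 288 * fps_XD qZ - 144 * qZ ^ 2 + 4 * quad0 qa qb qc qe qf"

text \<open>The sign patterns that define \<open>qT\<close> and \<open>qS\<close> turn the four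
  linear forms into \<open>8 * (qc - qe)\<close> and \<open>6 * (qa - qb)\<close>, so these two
  errors are no independent unknowns.\<close>

lemma err_t_eq: "8 * err_t = err_x 1 - err_x 2 + err_x 7 - err_x 14"
  and err_s_eq: "6 * err_s = err_x 1 - err_x 2 - err_x 7 + err_x 14"
  unfolding err_t_def err_s_def err_x_def at_cusp_simps lin_def using qT_eq qS_eq by algebra+

text \<open>Add Ramanujan's first equation over the four \<open>d\<close>. The cross terms with
  \<open>qZ\<close> cancel because the \<open>eis2 d - 6 * qZ\<close> add up to zero.\<close>

lemma err_z_eq:
  "err_z = (2 * at_cusp 1 lin * err_x 1 + err_x 1 * err_x 1 - err_y 1)
    + (2 * at_cusp 2 lin * err_x 2 + err_x 2 * err_x 2 - err_y 2)
    + (2 * at_cusp 7 lin * err_x 7 + err_x 7 * err_x 7 - err_y 7)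
    + (2 * at_cusp 14 lin * err_x 14 + err_x 14 * err_x 14 - err_y 14)"
proof -
  have "24 * fps_XD qZ = fps_XD (24 * qZ)" by (simp add: XD_mult XD_simps)
  also have "\<dots> = fps_XD (eis2 1) + fps_XD (eis2 2) + fps_XD (eis2 7) + fps_XD (eis2 14)"
    unfolding qZ_eq by simp
  finally have *: "288 * fps_XD qZ = (eis2 1 ^ 2 - eis4 1) + (eis2 2 ^ 2 - eis4 2) + (eis2 7 ^ 2 - eis4
      7)
      + (eis2 14 ^ 2 - eis4 14)"
    using ramanujan(1)[of 1] ramanujan(1)[of 2] ramanujan(1)[of 7] ramanujan(1)[of 14] by (simp del:
        One_nat_def) algebra
  show ?thesis
    unfolding err_z_def * err_x_def err_y_def at_cusp_simps quad_def quad0_def lin_def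
    using qZ_eq by algebra
qed

text \<open>The derivative is \<open>qZ * err_r + qS * (qc - qe) - qT * (qa - qb)\<close>; the
  product \<open>(qa - qb) * (qc - qe)\<close> occurs in both last terms and cancels.\<close>

lemma XD_err_r: "fps_XD err_r = qZ * err_r + (qc - qe) * err_s - (qa - qb) * err_t"
  unfolding err_r_def err_s_def err_t_def fps_XD_add XD_simps XD_mult XD_q by algebra

text \<open>The identity substitution. For \<open>d = 2\<close> the signs of \<open>err_t\<close>
  and \<open>err_s\<close> change, for \<open>d = 7\<close> those of \<open>err_s\<close> and
  \<open>err_r\<close>, for \<open>d = 14\<close> those of \<open>err_t\<close> and
  \<open>err_r\<close>.\<close>

lemma error_equations_1:
  "48 * fps_XD (err_x 1) = 48 * qZ * err_x 1 + 8 * at_cusp 1 lin * err_x 1 + 4 * err_x 1 * err_x 1 - 4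
      * err_y 1 - err_z
      - 48 * at_cusp 1 lin_t * err_t - 48 * at_cusp 1 lin_s * err_s"
  "3 * fps_XD (err_y 1) = 6 * qZ * err_y 1 + at_cusp 1 lin * err_y 1 + eis4 1 * err_x 1 - err_w 1
      - 3 * at_cusp 1 quad_t * err_t - 3 * at_cusp 1 quad_s * err_s"
  "2 * fps_XD (err_w 1) = 6 * qZ * err_w 1 + at_cusp 1 lin * err_w 1 + eis6 1 * err_x 1
      - (eis4 1 + at_cusp 1 quad) * err_y 1 + at_cusp 1 cub_r * err_r
      - 2 * at_cusp 1 cub_t * err_t - 2 * at_cusp 1 cub_s * err_s"
proof -
  note eqs = error_equations[of "qa" qZ "qT" "qb" "qc" "qS" "qe" "qf"
      "eis2 1" "eis4 1" "eis6 1" err_z "err_x 1" "err_y 1" "err_w 1" "err_t" "err_s" "err_r"]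
  have pos: "0 < (1 :: nat)" by simp
  have XD: "fps_XD (qa) = (qa) * (qZ + (qT))" "fps_XD (qb) = (qb) * (qZ - (qT))"
    "fps_XD (qc) = (qc) * (qZ + (qS))" "fps_XD (qe) = (qe) * (qZ - (qS))"
    "fps_XD (qf) = (qf) * qZ"
    unfolding XD_simps XD_q by (rule refl | algebra)+
  have prods: "(qa) * (qb) = 8 * (qf) ^ 2" "(qc) * (qe) = (qf) ^ 2"
    by (rule q_products | insert q_products, algebra)+
  have Z: "288 * fps_XD qZ = 144 * qZ ^ 2 - 4 * quad0 qa qb qc qe qf + err_z"
    unfolding err_z_def quad0_def by algebra
  have tsr: "err_t = (qT) - ((qc) - (qe))" "err_s = (qS) - ((qa) - (qb))"
    "err_r = (qc) + (qe) - (qa) - (qb) - 7 * (qf)"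
    unfolding err_t_def err_s_def err_r_def by (rule refl | algebra)+
  note eqs' = eqs[OF XD prods ramanujan[OF pos] Z err_x_def[of 1, unfolded at_cusp_simps]
      err_y_def[of 1, unfolded at_cusp_simps] err_w_def[of 1, unfolded at_cusp_simps] tsr]
  show "48 * fps_XD (err_x 1) = 48 * qZ * err_x 1 + 8 * at_cusp 1 lin * err_x 1 + 4 * err_x 1 * err_x 1
      - 4 * err_y 1 - err_z
      - 48 * at_cusp 1 lin_t * err_t - 48 * at_cusp 1 lin_s * err_s"
    "3 * fps_XD (err_y 1) = 6 * qZ * err_y 1 + at_cusp 1 lin * err_y 1 + eis4 1 * err_x 1 - err_w 1
      - 3 * at_cusp 1 quad_t * err_t - 3 * at_cusp 1 quad_s * err_s"
    "2 * fps_XD (err_w 1) = 6 * qZ * err_w 1 + at_cusp 1 lin * err_w 1 + eis6 1 * err_x 1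
      - (eis4 1 + at_cusp 1 quad) * err_y 1 + at_cusp 1 cub_r * err_r
      - 2 * at_cusp 1 cub_t * err_t - 2 * at_cusp 1 cub_s * err_s"
    using eqs' unfolding at_cusp_simps by (simp_all only: minus_mult_minus mult_minus_right
        diff_minus_eq_add add_uminus_conv_diff zero_less_numeral zero_less_one simp_thms)
qed

lemma error_equations_2:
  "48 * fps_XD (err_x 2) = 48 * qZ * err_x 2 + 8 * at_cusp 2 lin * err_x 2 + 4 * err_x 2 * err_x 2 - 4
      * err_y 2 - err_z
      + 48 * at_cusp 2 lin_t * err_t + 48 * at_cusp 2 lin_s * err_s"
  "3 * fps_XD (err_y 2) = 6 * qZ * err_y 2 + at_cusp 2 lin * err_y 2 + eis4 2 * err_x 2 - err_w 2
      + 3 * at_cusp 2 quad_t * err_t + 3 * at_cusp 2 quad_s * err_s"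
  "2 * fps_XD (err_w 2) = 6 * qZ * err_w 2 + at_cusp 2 lin * err_w 2 + eis6 2 * err_x 2
      - (eis4 2 + at_cusp 2 quad) * err_y 2 + at_cusp 2 cub_r * err_r
      + 2 * at_cusp 2 cub_t * err_t + 2 * at_cusp 2 cub_s * err_s"
proof -
  note eqs = error_equations[of "qb" qZ "- qT" "qa" "qe" "- qS" "qc" "qf"
      "eis2 2" "eis4 2" "eis6 2" err_z "err_x 2" "err_y 2" "err_w 2" "- err_t" "- err_s" "err_r"]
  have pos: "0 < (2 :: nat)" by simp
  have XD: "fps_XD (qb) = (qb) * (qZ + (- qT))" "fps_XD (qa) = (qa) * (qZ - (- qT))"
    "fps_XD (qe) = (qe) * (qZ + (- qS))" "fps_XD (qc) = (qc) * (qZ - (- qS))"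
    "fps_XD (qf) = (qf) * qZ"
    unfolding XD_simps XD_q by (rule refl | algebra)+
  have prods: "(qb) * (qa) = 8 * (qf) ^ 2" "(qe) * (qc) = (qf) ^ 2"
    by (rule q_products | insert q_products, algebra)+
  \<comment> \<open>\<open>quad0\<close> is invariant under all four substitutions, so the single
    error \<open>err_z\<close> serves every \<open>d\<close>.\<close>
  have Z: "288 * fps_XD qZ = 144 * qZ ^ 2 - 4 * quad0 qb qa qe qc qf + err_z"
    unfolding err_z_def quad0_def by algebra
  have tsr: "- err_t = (- qT) - ((qe) - (qc))" "- err_s = (- qS) - ((qb) - (qa))"
    "err_r = (qe) + (qc) - (qb) - (qa) - 7 * (qf)"
    unfolding err_t_def err_s_def err_r_def by (rule refl | algebra)+
  note eqs' = eqs[OF XD prods ramanujan[OF pos] Z err_x_def[of 2, unfolded at_cusp_simps]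
      err_y_def[of 2, unfolded at_cusp_simps] err_w_def[of 2, unfolded at_cusp_simps] tsr]
  show "48 * fps_XD (err_x 2) = 48 * qZ * err_x 2 + 8 * at_cusp 2 lin * err_x 2 + 4 * err_x 2 * err_x 2
      - 4 * err_y 2 - err_z
      + 48 * at_cusp 2 lin_t * err_t + 48 * at_cusp 2 lin_s * err_s"
    "3 * fps_XD (err_y 2) = 6 * qZ * err_y 2 + at_cusp 2 lin * err_y 2 + eis4 2 * err_x 2 - err_w 2
      + 3 * at_cusp 2 quad_t * err_t + 3 * at_cusp 2 quad_s * err_s"
    "2 * fps_XD (err_w 2) = 6 * qZ * err_w 2 + at_cusp 2 lin * err_w 2 + eis6 2 * err_x 2
      - (eis4 2 + at_cusp 2 quad) * err_y 2 + at_cusp 2 cub_r * err_r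
      + 2 * at_cusp 2 cub_t * err_t + 2 * at_cusp 2 cub_s * err_s"
    using eqs' unfolding at_cusp_simps by (simp_all only: minus_mult_minus mult_minus_right
        diff_minus_eq_add add_uminus_conv_diff zero_less_numeral zero_less_one simp_thms)
qed

lemma error_equations_7:
  "48 * fps_XD (err_x 7) = 48 * qZ * err_x 7 + 8 * at_cusp 7 lin * err_x 7 + 4 * err_x 7 * err_x 7 - 4
      * err_y 7 - err_z
      - 48 * at_cusp 7 lin_t * err_t + 48 * at_cusp 7 lin_s * err_s"
  "3 * fps_XD (err_y 7) = 6 * qZ * err_y 7 + at_cusp 7 lin * err_y 7 + eis4 7 * err_x 7 - err_w 7
      - 3 * at_cusp 7 quad_t * err_t + 3 * at_cusp 7 quad_s * err_s"
  "2 * fps_XD (err_w 7) = 6 * qZ * err_w 7 + at_cusp 7 lin * err_w 7 + eis6 7 * err_x 7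
      - (eis4 7 + at_cusp 7 quad) * err_y 7 - at_cusp 7 cub_r * err_r
      - 2 * at_cusp 7 cub_t * err_t + 2 * at_cusp 7 cub_s * err_s"
proof -
  note eqs = error_equations[of "- qa" qZ "qT" "- qb" "- qe" "- qS" "- qc" "- qf"
      "eis2 7" "eis4 7" "eis6 7" err_z "err_x 7" "err_y 7" "err_w 7" "err_t" "- err_s" "- err_r"]
  have pos: "0 < (7 :: nat)" by simp
  have XD: "fps_XD (- qa) = (- qa) * (qZ + (qT))" "fps_XD (- qb) = (- qb) * (qZ - (qT))"
    "fps_XD (- qe) = (- qe) * (qZ + (- qS))" "fps_XD (- qc) = (- qc) * (qZ - (- qS))"
    "fps_XD (- qf) = (- qf) * qZ"
    unfolding XD_simps XD_q by (rule refl | algebra)+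
  have prods: "(- qa) * (- qb) = 8 * (- qf) ^ 2" "(- qe) * (- qc) = (- qf) ^ 2"
    by (rule q_products | insert q_products, algebra)+
  have Z: "288 * fps_XD qZ = 144 * qZ ^ 2 - 4 * quad0 (- qa) (- qb) (- qe) (- qc) (- qf) + err_z"
    unfolding err_z_def quad0_def by algebra
  have tsr: "err_t = (qT) - ((- qe) - (- qc))" "- err_s = (- qS) - ((- qa) - (- qb))"
    "- err_r = (- qe) + (- qc) - (- qa) - (- qb) - 7 * (- qf)"
    unfolding err_t_def err_s_def err_r_def by (rule refl | algebra)+
  note eqs' = eqs[OF XD prods ramanujan[OF pos] Z err_x_def[of 7, unfolded at_cusp_simps]
      err_y_def[of 7, unfolded at_cusp_simps] err_w_def[of 7, unfolded at_cusp_simps] tsr]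
  show "48 * fps_XD (err_x 7) = 48 * qZ * err_x 7 + 8 * at_cusp 7 lin * err_x 7 + 4 * err_x 7 * err_x 7
      - 4 * err_y 7 - err_z
      - 48 * at_cusp 7 lin_t * err_t + 48 * at_cusp 7 lin_s * err_s"
    "3 * fps_XD (err_y 7) = 6 * qZ * err_y 7 + at_cusp 7 lin * err_y 7 + eis4 7 * err_x 7 - err_w 7
      - 3 * at_cusp 7 quad_t * err_t + 3 * at_cusp 7 quad_s * err_s"
    "2 * fps_XD (err_w 7) = 6 * qZ * err_w 7 + at_cusp 7 lin * err_w 7 + eis6 7 * err_x 7
      - (eis4 7 + at_cusp 7 quad) * err_y 7 - at_cusp 7 cub_r * err_r
      - 2 * at_cusp 7 cub_t * err_t + 2 * at_cusp 7 cub_s * err_s"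
    using eqs' unfolding at_cusp_simps by (simp_all only: minus_mult_minus mult_minus_right
        diff_minus_eq_add add_uminus_conv_diff zero_less_numeral zero_less_one simp_thms)
qed

lemma error_equations_14:
  "48 * fps_XD (err_x 14) = 48 * qZ * err_x 14 + 8 * at_cusp 14 lin * err_x 14 + 4 * err_x 14 * err_x
      14 - 4 * err_y 14 - err_z
      + 48 * at_cusp 14 lin_t * err_t - 48 * at_cusp 14 lin_s * err_s"
  "3 * fps_XD (err_y 14) = 6 * qZ * err_y 14 + at_cusp 14 lin * err_y 14 + eis4 14 * err_x 14 - err_w 14
      + 3 * at_cusp 14 quad_t * err_t - 3 * at_cusp 14 quad_s * err_s"
  "2 * fps_XD (err_w 14) = 6 * qZ * err_w 14 + at_cusp 14 lin * err_w 14 + eis6 14 * err_x 14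
      - (eis4 14 + at_cusp 14 quad) * err_y 14 - at_cusp 14 cub_r * err_r
      + 2 * at_cusp 14 cub_t * err_t - 2 * at_cusp 14 cub_s * err_s"
proof -
  note eqs = error_equations[of "- qb" qZ "- qT" "- qa" "- qc" "qS" "- qe" "- qf"
      "eis2 14" "eis4 14" "eis6 14" err_z "err_x 14" "err_y 14" "err_w 14" "- err_t" "err_s" "- err_r"]
  have pos: "0 < (14 :: nat)" by simp
  have XD: "fps_XD (- qb) = (- qb) * (qZ + (- qT))" "fps_XD (- qa) = (- qa) * (qZ - (- qT))"
    "fps_XD (- qc) = (- qc) * (qZ + (qS))" "fps_XD (- qe) = (- qe) * (qZ - (qS))"
    "fps_XD (- qf) = (- qf) * qZ"
    unfolding XD_simps XD_q by (rule refl | algebra)+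
  have prods: "(- qb) * (- qa) = 8 * (- qf) ^ 2" "(- qc) * (- qe) = (- qf) ^ 2"
    by (rule q_products | insert q_products, algebra)+
  have Z: "288 * fps_XD qZ = 144 * qZ ^ 2 - 4 * quad0 (- qb) (- qa) (- qc) (- qe) (- qf) + err_z"
    unfolding err_z_def quad0_def by algebra
  have tsr: "- err_t = (- qT) - ((- qc) - (- qe))" "err_s = (qS) - ((- qb) - (- qa))"
    "- err_r = (- qc) + (- qe) - (- qb) - (- qa) - 7 * (- qf)"
    unfolding err_t_def err_s_def err_r_def by (rule refl | algebra)+
  note eqs' = eqs[OF XD prods ramanujan[OF pos] Z err_x_def[of 14, unfolded at_cusp_simps]
      err_y_def[of 14, unfolded at_cusp_simps] err_w_def[of 14, unfolded at_cusp_simps] tsr]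
  show "48 * fps_XD (err_x 14) = 48 * qZ * err_x 14 + 8 * at_cusp 14 lin * err_x 14 + 4 * err_x 14 *
      err_x 14 - 4 * err_y 14 - err_z
      + 48 * at_cusp 14 lin_t * err_t - 48 * at_cusp 14 lin_s * err_s"
    "3 * fps_XD (err_y 14) = 6 * qZ * err_y 14 + at_cusp 14 lin * err_y 14 + eis4 14 * err_x 14 - err_w
        14
      + 3 * at_cusp 14 quad_t * err_t - 3 * at_cusp 14 quad_s * err_s"
    "2 * fps_XD (err_w 14) = 6 * qZ * err_w 14 + at_cusp 14 lin * err_w 14 + eis6 14 * err_x 14
      - (eis4 14 + at_cusp 14 quad) * err_y 14 - at_cusp 14 cub_r * err_r
      + 2 * at_cusp 14 cub_t * err_t - 2 * at_cusp 14 cub_s * err_s"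
    using eqs' unfolding at_cusp_simps by (simp_all only: minus_mult_minus mult_minus_right
        diff_minus_eq_add add_uminus_conv_diff zero_less_numeral zero_less_one simp_thms)
qed

section \<open>Constant terms and the recurrence for the errors\<close>

lemma q_0 [simp]: "qa $ 0 = 1" "qb $ 0 = 0" "qc $ 0 = 0" "qe $ 0 = 1" "qf $ 0 = 0" "qZ $ 0 = 1"
  by (simp_all add: qa_def qb_def qc_def qe_def qf_def qZ_def eis2_def dilate_nth lambert_nth
        numeral_fps_const fps_power_zeroth fps_of_nat[symmetric])

lemma eis_0: "d > 0 \<Longrightarrow> eis4 d $ 0 = real d ^ 2" "d > 0 \<Longrightarrow> eis6 d $ 0 =
    real d ^ 3"
  by (simp_all add: eis4_def eis6_def dilate_nth lambert_nth numeral_fps_const fps_power_zeroth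
      fps_of_nat[symmetric])

text \<open>At \<open>q = 0\<close> the five eta quotients are \<open>(1, 0, 0, 1, 0)\<close>;
  evaluating the forms at the four images of this point gives entries of the recurrence
  matrix.\<close>

lemma at_cusp_0:
  "at_cusp 1 lin $ 0 = -5" "at_cusp 1 lin_t $ 0 = -3" "at_cusp 1 lin_s $ 0 = 2" "at_cusp 1 quad $ 0 =
      1" "at_cusp 1 quad_t $ 0 = 42" "at_cusp 1 quad_s $ 0 = 40" "at_cusp 1 cub_t $ 0 = -81" "at_cusp 1
      cub_s $ 0 = -84" "at_cusp 1 cub_r $ 0 = 0"
  "at_cusp 2 lin $ 0 = -4" "at_cusp 2 lin_t $ 0 = 6" "at_cusp 2 lin_s $ 0 = 2" "at_cusp 2 quad $ 0 = 4"
      "at_cusp 2 quad_t $ 0 = -72" "at_cusp 2 quad_s $ 0 = -64" "at_cusp 2 cub_t $ 0 = 72" "at_cusp 2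
      cub_s $ 0 = 96" "at_cusp 2 cub_r $ 0 = 576"
  "at_cusp 7 lin $ 0 = 1" "at_cusp 7 lin_t $ 0 = 3" "at_cusp 7 lin_s $ 0 = -2" "at_cusp 7 quad $ 0 =
      49" "at_cusp 7 quad_t $ 0 = 90" "at_cusp 7 quad_s $ 0 = 8" "at_cusp 7 cub_t $ 0 = 801" "at_cusp 7
      cub_s $ 0 = 228" "at_cusp 7 cub_r $ 0 = -1728"
  "at_cusp 14 lin $ 0 = 8" "at_cusp 14 lin_t $ 0 = -6" "at_cusp 14 lin_s $ 0 = -2" "at_cusp 14 quad $ 0
      = 196" "at_cusp 14 quad_t $ 0 = -264" "at_cusp 14 quad_s $ 0 = -128" "at_cusp 14 cub_t $ 0 =
      -5256" "at_cusp 14 cub_s $ 0 = -2976" "at_cusp 14 cub_r $ 0 = -7488"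
  unfolding at_cusp_simps form_defs by (simp_all add: fps_power_zeroth)

lemma fps_numeral_mult_nth: "(numeral k * F) $ n = numeral k * (F $ n :: real)"
  by (simp add: numeral_fps_const)

text \<open>This is why only the constant terms of the coefficient series enter the recurrence for
  the first possibly nonzero error.\<close>

lemma fps_mult_nth_lowest:
  assumes "\<And>k. k < N \<Longrightarrow> G $ k = 0"
  shows "(F * G) $ N = F $ 0 * (G $ N :: real)"
proof -
  have "(F * G) $ N = (\<Sum>i = 0..N. if i = 0 then F $ 0 * G $ N else 0)"
    unfolding fps_mult_nth using assms by (intro sum.cong) auto
  then show ?thesis by simp
qed

text \<open>The weights in \<open>m\<close> are chosen so that each weighted column sum of the matrix
  of absolute values of the recurrence is at most 18 times the weight of that column; its
  spectral radius is about 14.73.\<close>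
lemma error_recurrence_trivial:
  fixes N x1 x2 x7 x14 y1 y2 y7 y14 w1 w2 w7 w14 r z t s :: real
  assumes "N \<ge> 19"
    and zts: "z = -10 * x1 - 8 * x2 + 2 * x7 + 16 * x14 - y1 - y2 - y7 - y14" "8 * t = x1 - x2 + x7 -
        x14" "6 * s = x1 - x2 - x7 + x14"
    and eqs: "48 * (N * x1) = 8 * x1 - 4 * y1 - z + 144 * t - 96 * s"
      "48 * (N * x2) = 16 * x2 - 4 * y2 - z + 288 * t + 96 * s"
      "48 * (N * x7) = 56 * x7 - 4 * y7 - z - 144 * t - 96 * s"
      "48 * (N * x14) = 112 * x14 - 4 * y14 - z - 288 * t + 96 * s"
      "3 * (N * y1) = y1 + x1 - w1 - 126 * t - 120 * s"
      "3 * (N * y2) = 2 * y2 + 4 * x2 - w2 - 216 * t - 192 * s"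
      "3 * (N * y7) = 7 * y7 + 49 * x7 - w7 - 270 * t + 24 * s"
      "3 * (N * y14) = 14 * y14 + 196 * x14 - w14 - 792 * t + 384 * s"
      "2 * (N * w1) = w1 + x1 - 2 * y1 + 162 * t + 168 * s"
      "2 * (N * w2) = 2 * w2 + 8 * x2 - 8 * y2 + 576 * r + 144 * t + 192 * s"
      "2 * (N * w7) = 7 * w7 + 343 * x7 - 98 * y7 + 1728 * r - 1602 * t + 456 * s"
      "2 * (N * w14) = 14 * w14 + 2744 * x14 - 392 * y14 + 7488 * r - 10512 * t + 5952 * s"
      "N * r = r - s - t"
  shows "x1 = 0 \<and> x2 = 0 \<and> x7 = 0 \<and> x14 = 0 \<and> y1 = 0 \<and> y2 = 0 \<and> y7 = 0
      \<and> y14 = 0 \<and> w1 = 0 \<and> w2 = 0 \<and> w7 = 0 \<and> w14 = 0 \<and> r = 0"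
proof -
  have bound: "N * \<bar>v\<bar> \<le> u" if "N * v \<le> u" "- (N * v) \<le> u" for v u
    using that \<open>N \<ge> 19\<close> by (auto simp: abs_if)
  define px1 and px2 and px7 and px14 and py1 and py2 and py7 and py14 and pw1 and pw2 and pw7 and pw14
      and pr where p: "px1 = \<bar>x1\<bar>" "px2 = \<bar>x2\<bar>" "px7 = \<bar>x7\<bar>" "px14 =
      \<bar>x14\<bar>" "py1 = \<bar>y1\<bar>" "py2 = \<bar>y2\<bar>" "py7 = \<bar>y7\<bar>" "py14 =
      \<bar>y14\<bar>" "pw1 = \<bar>w1\<bar>" "pw2 = \<bar>w2\<bar>" "pw7 = \<bar>w7\<bar>" "pw14 =
      \<bar>w14\<bar>" "pr = \<bar>r\<bar>"
  have px1: "x1 \<le> px1" "- x1 \<le> px1" "0 \<le> px1" unfolding p(1) by simp_all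
  have px2: "x2 \<le> px2" "- x2 \<le> px2" "0 \<le> px2" unfolding p(2) by simp_all
  have px7: "x7 \<le> px7" "- x7 \<le> px7" "0 \<le> px7" unfolding p(3) by simp_all
  have px14: "x14 \<le> px14" "- x14 \<le> px14" "0 \<le> px14" unfolding p(4) by simp_all
  have py1: "y1 \<le> py1" "- y1 \<le> py1" "0 \<le> py1" unfolding p(5) by simp_all
  have py2: "y2 \<le> py2" "- y2 \<le> py2" "0 \<le> py2" unfolding p(6) by simp_all
  have py7: "y7 \<le> py7" "- y7 \<le> py7" "0 \<le> py7" unfolding p(7) by simp_all
  have py14: "y14 \<le> py14" "- y14 \<le> py14" "0 \<le> py14" unfolding p(8) by simp_all
  have pw1: "w1 \<le> pw1" "- w1 \<le> pw1" "0 \<le> pw1" unfolding p(9) by simp_all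
  have pw2: "w2 \<le> pw2" "- w2 \<le> pw2" "0 \<le> pw2" unfolding p(10) by simp_all
  have pw7: "w7 \<le> pw7" "- w7 \<le> pw7" "0 \<le> pw7" unfolding p(11) by simp_all
  have pw14: "w14 \<le> pw14" "- w14 \<le> pw14" "0 \<le> pw14" unfolding p(12) by simp_all
  have pr: "r \<le> pr" "- r \<le> pr" "0 \<le> pr" unfolding p(13) by simp_all
  \<comment> \<open>Each bound eliminates \<open>z\<close>, \<open>t\<close>, \<open>s\<close> and
    replaces the remaining coefficients by their absolute values.\<close>
  have b0: "N * px1 \<le> 5/12 * px1 + 1/8 * px2 + 2/3 * px7 + 25/24 * px14 + 1/16 * py1 + 1/48 * py2 +
      1/48 * py7 + 1/48 * py14"
    by (subst p(1), rule bound; insert zts eqs(1) px1 px2 px7 px14 py1 py2 py7 py14; linarith)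
  have b1: "N * px2 \<le> 31/24 * px1 + 7/12 * px2 + 3/8 * px7 + 3/4 * px14 + 1/48 * py1 + 1/16 * py2 +
      1/48 * py7 + 1/48 * py14"
    by (subst p(2), rule bound; insert zts eqs(2) px1 px2 px7 px14 py1 py2 py7 py14; linarith)
  have b2: "N * px7 \<le> 1/2 * px1 + 7/8 * px2 + 13/12 * px7 + 7/24 * px14 + 1/48 * py1 + 1/48 * py2 +
      1/16 * py7 + 1/48 * py14"
    by (subst p(3), rule bound; insert zts eqs(3) px1 px2 px7 px14 py1 py2 py7 py14; linarith)
  have b3: "N * px14 \<le> 5/24 * px1 + 7/12 * px2 + 9/8 * px7 + 37/12 * px14 + 1/48 * py1 + 1/48 * py2
      + 1/48 * py7 + 1/16 * py14"
    by (subst p(4), rule bound; insert zts eqs(4) px1 px2 px7 px14 py1 py2 py7 py14; linarith)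
  have b4: "N * py1 \<le> 139/12 * px1 + 143/12 * px2 + 17/12 * px7 + 17/12 * px14 + 1/3 * py1 + 1/3 *
      pw1"
    by (subst p(5), rule bound; insert zts eqs(5) px1 px2 px7 px14 py1 pw1; linarith)
  have b5: "N * py2 \<le> 59/3 * px1 + 21 * px2 + 5/3 * px7 + 5/3 * px14 + 2/3 * py2 + 1/3 * pw2"
    by (subst p(6), rule bound; insert zts eqs(6) px1 px2 px7 px14 py2 pw2; linarith)
  have b6: "N * py7 \<le> 119/12 * px1 + 119/12 * px2 + 15/4 * px7 + 151/12 * px14 + 7/3 * py7 + 1/3 *
      pw7"
    by (subst p(7), rule bound; insert zts eqs(7) px1 px2 px7 px14 py7 pw7; linarith)
  have b7: "N * py14 \<le> 35/3 * px1 + 35/3 * px2 + 163/3 * px7 + 359/3 * px14 + 14/3 * py14 + 1/3 *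
      pw14"
    by (subst p(8), rule bound; insert zts eqs(8) px1 px2 px7 px14 py14 pw14; linarith)
  have b8: "N * pw1 \<le> 197/8 * px1 + 193/8 * px2 + 31/8 * px7 + 31/8 * px14 + py1 + 1/2 * pw1"
    by (subst p(9), rule bound; insert zts eqs(9) px1 px2 px7 px14 py1 pw1; linarith)
  have b9: "N * pw2 \<le> 25 * px1 + 21 * px2 + 7 * px7 + 7 * px14 + 4 * py2 + pw2 + 288 * pr"
    by (subst p(10), rule bound; insert zts eqs(10) px1 px2 px7 px14 py2 pw2 pr; linarith)
  have b10: "N * pw7 \<le> 497/8 * px1 + 497/8 * px2 + 267/8 * px7 + 1105/8 * px14 + 49 * py7 + 7/2 *
      pw7 + 864 * pr"
    by (subst p(11), rule bound; insert zts eqs(11) px1 px2 px7 px14 py7 pw7 pr; linarith)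
  have b11: "N * pw14 \<le> 161 * px1 + 161 * px2 + 1153 * px7 + 2525 * px14 + 196 * py14 + 7 * pw14 +
      3744 * pr"
    by (subst p(12), rule bound; insert zts eqs(12) px1 px2 px7 px14 py14 pw14 pr; linarith)
  have b12: "N * pr \<le> 7/24 * px1 + 7/24 * px2 + 1/24 * px7 + 1/24 * px14 + pr"
    by (subst p(13), rule bound; insert zts eqs(13) px1 px2 px7 px14 pr; linarith)
  define m where "m = 131 * px1 + 153 * px2 + 460 * px7 + 988 * px14 + 3 * py1 + 4 * py2 + 9 * py7 + 52
      * py14 + pw1 + pw2 + pw7 + 3 * pw14 + 762 * pr"
  have "N * m = 131 * (N * px1) + 153 * (N * px2) + 460 * (N * px7) + 988 * (N * px14) + 3 * (N * py1)
      + 4 * (N * py2) + 9 * (N * py7) + 52 * (N * py14) + (N * pw1) + (N * pw2) + (N * pw7) + 3 * (N *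
      pw14) + 762 * (N * pr)"
    by (simp add: m_def algebra_simps)
  also have "\<dots> \<le> 131 * (5/12 * px1 + 1/8 * px2 + 2/3 * px7 + 25/24 * px14 + 1/16 * py1 + 1/48
      * py2 + 1/48 * py7 + 1/48 * py14) + 153 * (31/24 * px1 + 7/12 * px2 + 3/8 * px7 + 3/4 * px14 +
      1/48 * py1 + 1/16 * py2 + 1/48 * py7 + 1/48 * py14) + 460 * (1/2 * px1 + 7/8 * px2 + 13/12 * px7
      + 7/24 * px14 + 1/48 * py1 + 1/48 * py2 + 1/16 * py7 + 1/48 * py14) + 988 * (5/24 * px1 + 7/12 *
      px2 + 9/8 * px7 + 37/12 * px14 + 1/48 * py1 + 1/48 * py2 + 1/48 * py7 + 1/16 * py14) + 3 *
      (139/12 * px1 + 143/12 * px2 + 17/12 * px7 + 17/12 * px14 + 1/3 * py1 + 1/3 * pw1) + 4 * (59/3 *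
      px1 + 21 * px2 + 5/3 * px7 + 5/3 * px14 + 2/3 * py2 + 1/3 * pw2) + 9 * (119/12 * px1 + 119/12 *
      px2 + 15/4 * px7 + 151/12 * px14 + 7/3 * py7 + 1/3 * pw7) + 52 * (35/3 * px1 + 35/3 * px2 + 163/3
      * px7 + 359/3 * px14 + 14/3 * py14 + 1/3 * pw14) + (197/8 * px1 + 193/8 * px2 + 31/8 * px7 + 31/8
      * px14 + py1 + 1/2 * pw1) + (25 * px1 + 21 * px2 + 7 * px7 + 7 * px14 + 4 * py2 + pw2 + 288 * pr)
      + (497/8 * px1 + 497/8 * px2 + 267/8 * px7 + 1105/8 * px14 + 49 * py7 + 7/2 * pw7 + 864 * pr) + 3
      * (161 * px1 + 161 * px2 + 1153 * px7 + 2525 * px14 + 196 * py14 + 7 * pw14 + 3744 * pr) + 762 *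
      (7/24 * px1 + 7/24 * px2 + 1/24 * px7 + 1/24 * px14 + pr)"
    by (intro add_mono mult_left_mono b0 b1 b2 b3 b4 b5 b6 b7 b8 b9 b10 b11 b12) simp_all
  also have "\<dots> \<le> 18 * m"
    unfolding m_def using px1(3) px2(3) px7(3) px14(3) py1(3) py2(3) py7(3) py14(3) pw1(3) pw2(3)
        pw7(3) pw14(3) pr(3) by simp
  \<comment> \<open>Since \<open>N > 18\<close>, a combination of absolute values with positive
    weights is at most 0, so each of them is 0.\<close>
  finally have "(N - 18) * m \<le> 0" by (simp add: algebra_simps)
  then have "m \<le> 0" using \<open>N \<ge> 19\<close> by (simp add: mult_le_0_iff)
  then have "px1 = 0 \<and> px2 = 0 \<and> px7 = 0 \<and> px14 = 0 \<and> py1 = 0 \<and> py2 = 0 \<and>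
      py7 = 0 \<and> py14 = 0 \<and> pw1 = 0 \<and> pw2 = 0 \<and> pw7 = 0 \<and> pw14 = 0 \<and> pr =
      0"
    unfolding m_def using px1(3) px2(3) px7(3) px14(3) py1(3) py2(3) py7(3) py14(3) pw1(3) pw2(3)
        pw7(3) pw14(3) pr(3) by (intro conjI; linarith)
  then show ?thesis unfolding p by simp
qed

text \<open>\<open>err_t\<close>, \<open>err_s\<close> and \<open>err_z\<close> are left out, being
  determined by these errors.\<close>

definition errors_vanish :: "nat \<Rightarrow> bool" where
  "errors_vanish k \<longleftrightarrow> (\<forall>d \<in> {1, 2, 7, 14}. err_x d $ k = 0 \<and> err_y
      d $ k = 0 \<and> err_w d $ k = 0) \<and> err_r $ k = 0"

lemma errors_vanish_step:
  assumes "N \<ge> 19" and low: "\<And>k. k < N \<Longrightarrow> errors_vanish k"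
  shows "errors_vanish N"
proof -
  have lx: "\<And>k. k < N \<Longrightarrow> err_x d $ k = 0" and ly: "\<And>k. k < N \<Longrightarrow>
      err_y d $ k = 0"
    and lw: "\<And>k. k < N \<Longrightarrow> err_w d $ k = 0" if "d \<in> {1, 2, 7, 14}" for d
    using low that unfolding errors_vanish_def by blast+
  have lr: "\<And>k. k < N \<Longrightarrow> err_r $ k = 0"
    using low unfolding errors_vanish_def by blast
  have t: "8 * err_t $ k = err_x 1 $ k - err_x 2 $ k + err_x 7 $ k - err_x 14 $ k"
    and s: "6 * err_s $ k = err_x 1 $ k - err_x 2 $ k - err_x 7 $ k + err_x 14 $ k" for k
    using err_t_eq[THEN arg_cong[where f = "\<lambda>F. F $ k"]] err_s_eq[THEN arg_cong[where f =
        "\<lambda>F. F $ k"]]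
    by (simp_all only: fps_numeral_mult_nth fps_add_nth fps_sub_nth)
  have lt: "err_t $ k = 0" and ls: "err_s $ k = 0" if "k < N" for k
    using t[of k] s[of k] lx[OF _ that, of 1] lx[OF _ that, of 2] lx[OF _ that, of 7] lx[OF _ that, of
        14]
    by (simp_all del: One_nat_def)
  \<comment> \<open>With zero constant terms, the squares \<open>err_x d * err_x d\<close>
    contribute nothing at \<open>q^N\<close>, and the recurrence is linear.\<close>
  have x0: "err_x d $ 0 = 0" if "d \<in> {1, 2, 7, 14}" for d
    using lx[OF that] \<open>N \<ge> 19\<close> by simp
  note lowest = fps_mult_nth_lowest[of N "err_x d" for d, OF lx] fps_mult_nth_lowest[of N "err_y d" for
      d, OF ly]
    fps_mult_nth_lowest[of N "err_w d" for d, OF lw] fps_mult_nth_lowest[of N err_r, OF lr]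
    fps_mult_nth_lowest[of N err_t, OF lt] fps_mult_nth_lowest[of N err_s, OF ls]
  note nth = fps_XD_nth fps_add_nth fps_sub_nth lowest fps_numeral_mult_nth fps_mult_nth_0 at_cusp_0
      q_0 eis_0 x0
    fps_numeral_nth_0 insert_iff simp_thms mult_zero_left mult_zero_right mult_1_left mult_1_right
    of_nat_numeral of_nat_1 power_one zero_less_numeral zero_less_one
  have at_N: "F = G \<Longrightarrow> F $ N = G $ N" for F G :: "real fps" by simp
  have z: "err_z $ N = -10 * err_x 1 $ N - 8 * err_x 2 $ N + 2 * err_x 7 $ N + 16 * err_x 14 $ N -
      err_y 1 $ N - err_y 2 $ N - err_y 7 $ N - err_y 14 $ N"
    using at_N[OF err_z_eq] by (simp only: nth; simp)
  have e0: "48 * (real N * err_x 1 $ N) = 8 * err_x 1 $ N - 4 * err_y 1 $ N - err_z $ N + 144 * err_t $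
      N - 96 * err_s $ N"
    using at_N[OF error_equations_1(1)] by (simp only: nth; simp)
  have e1: "48 * (real N * err_x 2 $ N) = 16 * err_x 2 $ N - 4 * err_y 2 $ N - err_z $ N + 288 * err_t
      $ N + 96 * err_s $ N"
    using at_N[OF error_equations_2(1)] by (simp only: nth; simp)
  have e2: "48 * (real N * err_x 7 $ N) = 56 * err_x 7 $ N - 4 * err_y 7 $ N - err_z $ N - 144 * err_t
      $ N - 96 * err_s $ N"
    using at_N[OF error_equations_7(1)] by (simp only: nth; simp)
  have e3: "48 * (real N * err_x 14 $ N) = 112 * err_x 14 $ N - 4 * err_y 14 $ N - err_z $ N - 288 *
      err_t $ N + 96 * err_s $ N"
    using at_N[OF error_equations_14(1)] by (simp only: nth; simp)
  have e4: "3 * (real N * err_y 1 $ N) = err_y 1 $ N + err_x 1 $ N - err_w 1 $ N - 126 * err_t $ N -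
      120 * err_s $ N"
    using at_N[OF error_equations_1(2)] by (simp only: nth; simp)
  have e5: "3 * (real N * err_y 2 $ N) = 2 * err_y 2 $ N + 4 * err_x 2 $ N - err_w 2 $ N - 216 * err_t
      $ N - 192 * err_s $ N"
    using at_N[OF error_equations_2(2)] by (simp only: nth; simp)
  have e6: "3 * (real N * err_y 7 $ N) = 7 * err_y 7 $ N + 49 * err_x 7 $ N - err_w 7 $ N - 270 * err_t
      $ N + 24 * err_s $ N"
    using at_N[OF error_equations_7(2)] by (simp only: nth; simp)
  have e7: "3 * (real N * err_y 14 $ N) = 14 * err_y 14 $ N + 196 * err_x 14 $ N - err_w 14 $ N - 792 *
      err_t $ N + 384 * err_s $ N"
    using at_N[OF error_equations_14(2)] by (simp only: nth; simp)
  have e8: "2 * (real N * err_w 1 $ N) = err_w 1 $ N + err_x 1 $ N - 2 * err_y 1 $ N + 162 * err_t $ N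
      + 168 * err_s $ N"
    using at_N[OF error_equations_1(3)] by (simp only: nth; simp)
  have e9: "2 * (real N * err_w 2 $ N) = 2 * err_w 2 $ N + 8 * err_x 2 $ N - 8 * err_y 2 $ N + 576 *
      err_r $ N + 144 * err_t $ N + 192 * err_s $ N"
    using at_N[OF error_equations_2(3)] by (simp only: nth; simp)
  have e10: "2 * (real N * err_w 7 $ N) = 7 * err_w 7 $ N + 343 * err_x 7 $ N - 98 * err_y 7 $ N + 1728
      * err_r $ N - 1602 * err_t $ N + 456 * err_s $ N"
    using at_N[OF error_equations_7(3)] by (simp only: nth; simp)
  have e11: "2 * (real N * err_w 14 $ N) = 14 * err_w 14 $ N + 2744 * err_x 14 $ N - 392 * err_y 14 $ N
      + 7488 * err_r $ N - 10512 * err_t $ N + 5952 * err_s $ N"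
    using at_N[OF error_equations_14(3)] by (simp only: nth; simp)
  have e12: "real N * err_r $ N = err_r $ N - err_s $ N - err_t $ N"
    using at_N[OF XD_err_r] by (simp only: nth; simp)
  have "err_x 1 $ N = 0 \<and> err_x 2 $ N = 0 \<and> err_x 7 $ N = 0 \<and> err_x 14 $ N = 0 \<and>
      err_y 1 $ N = 0 \<and> err_y 2 $ N = 0 \<and> err_y 7 $ N = 0 \<and> err_y 14 $ N = 0 \<and>
      err_w 1 $ N = 0 \<and> err_w 2 $ N = 0 \<and> err_w 7 $ N = 0 \<and> err_w 14 $ N = 0 \<and>
      err_r $ N = 0"
    by (rule error_recurrence_trivial[OF _ z t s e0 e1 e2 e3 e4 e5 e6 e7 e8 e9 e10 e11 e12]) (use
        assms(1) in simp)
  then show ?thesis unfolding errors_vanish_def by simp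
qed

section \<open>The first coefficients\<close>

text \<open>The 19 coefficients are those below the bound \<open>N \<ge> 19\<close> of the
  recurrence; integer lists make their comparison a computation.\<close>

definition coeffs :: "int list \<Rightarrow> real fps \<Rightarrow> bool" where
  "coeffs xs F \<longleftrightarrow> length xs = 19 \<and> (\<forall>n<19. F $ n = of_int (xs ! n))"

text \<open>Cauchy product truncated to the length of the second list: the shift by one power of
  \<open>q\<close> drops the last entry.\<close>

fun list_mult :: "int list \<Rightarrow> int list \<Rightarrow> int list" where
  "list_mult [] ys = map (\<lambda>_. 0) ys"
| "list_mult (x # xs) ys = map2 (+) (map ((*) x) ys) (0 # list_mult xs (butlast ys))"

lemma length_list_mult [simp]: "length (list_mult xs ys) = length ys"
  by (induction xs ys rule: list_mult.induct) auto

lemma list_mult_nth: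
  assumes "length ys \<le> length xs" "n < length ys"
  shows "list_mult xs ys ! n = (\<Sum>i = 0..n. xs ! i * ys ! (n - i))"
  using assms
proof (induction xs ys arbitrary: n rule: list_mult.induct)
  case (2 x xs ys)
  show ?case
  proof (cases n)
    case 0
    with 2 show ?thesis by simp
  next
    case (Suc m)
    have "(\<Sum>i = 0..m. xs ! i * butlast ys ! (m - i)) = (\<Sum>i = 0..m. xs ! i * ys ! (m - i))"
      using 2(3) Suc by (intro sum.cong) (auto simp: nth_butlast)
    with 2 Suc show ?thesis
      by (simp add: sum.atLeast0_atMost_Suc_shift del: sum.cl_ivl_Suc)
  qed
qed simp

lemma coeffs_add: "coeffs xs F \<Longrightarrow> coeffs ys G \<Longrightarrow> coeffs (map2 (+) xs ys)
    (F + G)"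
  by (simp add: coeffs_def)

lemma coeffs_diff: "coeffs xs F \<Longrightarrow> coeffs ys G \<Longrightarrow> coeffs (map2 (-) xs ys)
    (F - G)"
  by (simp add: coeffs_def)

lemma coeffs_minus: "coeffs xs F \<Longrightarrow> coeffs (map uminus xs) (- F)"
  by (simp add: coeffs_def)

lemma coeffs_numeral_mult: "coeffs xs F \<Longrightarrow> coeffs (map ((*) (numeral k)) xs) (numeral k
    * F)"
  by (simp add: coeffs_def fps_numeral_mult_nth)

lemma coeffs_neg_numeral_mult: "coeffs xs F \<Longrightarrow> coeffs (map ((*) (- numeral k)) xs) (-
    numeral k * F)"
  by (simp add: coeffs_def fps_numeral_mult_nth)

lemma coeffs_mult: "coeffs xs F \<Longrightarrow> coeffs ys G \<Longrightarrow> coeffs (list_mult xs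
    ys) (F * G)"
  by (auto simp: coeffs_def list_mult_nth fps_mult_nth intro!: sum.cong)

lemma coeffs_power2: "coeffs xs F \<Longrightarrow> coeffs (list_mult xs xs) (F ^ 2)"
  unfolding power2_eq_square by (rule coeffs_mult)

lemmas coeffs_intros = coeffs_neg_numeral_mult coeffs_numeral_mult coeffs_power2 coeffs_mult
  coeffs_add coeffs_diff coeffs_minus

lemma coeffs_cancel_numeral:
  assumes "coeffs ys (numeral k * F)" and "ys = map ((*) (numeral k)) xs"
  shows "coeffs xs F"
  using assms by (auto simp: coeffs_def fps_numeral_mult_nth)

lemma coeffs_zero: "coeffs xs F \<Longrightarrow> xs = replicate 19 0 \<Longrightarrow> n < 19
    \<Longrightarrow> F $ n = 0"
  by (simp add: coeffs_def)

text \<open>Only the coefficient at the index \<open>G $ 0\<close> is not determined by the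
    recursion.\<close>
lemma coeffs_log_deriv:
  assumes XD: "fps_XD F = F * G" and G: "coeffs gs G" and len: "length xs = 19"
    and k: "gs ! 0 = int k" "F $ k = of_int (xs ! k)"
    and rec: "list_mult xs gs = map2 (*) (map int [0..<19]) xs"
  shows "coeffs xs F"
proof -
  have lens: "length gs = 19" using G by (simp add: coeffs_def)
  have "F $ n = of_int (xs ! n)" if "n < 19" for n
    using that
  proof (induction n rule: less_induct)
    case (less n)
    show ?case
    proof (cases "n = k")
      case False
      have "list_mult xs gs ! n = int n * xs ! n"
        using rec less.prems len by (simp del: upt_rec_numeral)
      then have "int n * xs ! n = (\<Sum>i = 0..n. xs ! i * gs ! (n - i))"
        using less.prems len lens by (simp add: list_mult_nth)
      also have "\<dots> = (\<Sum>i \<in> {0..<n}. xs ! i * gs ! (n - i)) + xs ! n * int k"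
        by (simp add: k(1) atLeastLessThanSuc_atLeastAtMost[symmetric])
      finally have "(int n - int k) * xs ! n = (\<Sum>i \<in> {0..<n}. xs ! i * gs ! (n - i))"
        by (simp add: algebra_simps)
      then have 1: "(real n - real k) * of_int (xs ! n) = (\<Sum>i \<in> {0..<n}. of_int (xs ! i) *
          of_int (gs ! (n - i)))"
        by (metis (mono_tags, lifting) of_int_mult of_int_diff of_int_of_nat_eq of_int_sum sum.cong)
      have "real n * F $ n = (\<Sum>i = 0..n. F $ i * G $ (n - i))"
        using XD[THEN arg_cong[where f = "\<lambda>F. F $ n"]] by (simp add: fps_mult_nth)
      also have "\<dots> = (\<Sum>i \<in> {0..<n}. F $ i * G $ (n - i)) + F $ n * real k"
        using G k(1) by (simp add: coeffs_def atLeastLessThanSuc_atLeastAtMost[symmetric])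
      also have "(\<Sum>i \<in> {0..<n}. F $ i * G $ (n - i)) = (\<Sum>i \<in> {0..<n}. of_int (xs ! i)
          * of_int (gs ! (n - i)))"
        using less G by (intro sum.cong) (auto simp: coeffs_def)
      finally have "(real n - real k) * F $ n = (real n - real k) * of_int (xs ! n)"
        using 1 by (simp add: algebra_simps)
      with False show ?thesis by simp
    qed (use k in simp)
  qed
  with len show ?thesis by (simp add: coeffs_def)
qed

definition sigma_int :: "nat \<Rightarrow> nat \<Rightarrow> int" where
  "sigma_int k n = sum_list (map (\<lambda>d. if d dvd n then int d ^ k else 0) [1..<Suc n])"

lemma sigma_k_eq_int: "sigma_k k n = of_int (sigma_int k n)"
proof -
  have "(\<Sum>d | d dvd n. real d ^ k) = (\<Sum>d \<in> {1..<Suc n}. if d dvd n then real d ^ k else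
      0)" if "n > 0"
  proof -
    have "{d. d dvd n} = {d \<in> {1..<Suc n}. d dvd n}"
      using that by (auto dest: dvd_imp_le intro: Nat.gr0I)
    then show ?thesis by (simp only: sum.inter_filter finite_atLeastLessThan)
  qed
  moreover have "of_int (sigma_int k n) = (\<Sum>d \<in> {1..<Suc n}. if d dvd n then real d ^ k else
      0)"
    unfolding sigma_int_def interv_sum_list_conv_sum_set_nat of_int_sum set_upt by (intro sum.cong) auto
  ultimately show ?thesis by (simp add: sigma_k_def)
qed

text \<open>\<open>w\<close> is the constant term, \<open>d\<close> or \<open>d ^ 2\<close>, and
  \<open>c\<close> the Eisenstein coefficient, \<open>-24\<close> or \<open>240\<close>.\<close>

definition eis_list :: "nat \<Rightarrow> int \<Rightarrow> int \<Rightarrow> nat \<Rightarrow> int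
    list" where
  "eis_list k w c d = map (\<lambda>n. if n = 0 then w else if d dvd n then w * c * sigma_int k (n div
      d) else 0) [0..<19]"

lemma coeffs_eis:
  assumes "d > 0"
  shows "coeffs (eis_list 1 (int d) (-24) d) (eis2 d)" "coeffs (eis_list 3 (int d ^ 2) 240 d) (eis4 d)"
  using assms by (auto simp: coeffs_def eis_list_def eis2_def eis4_def dilate_nth lambert_nth
      sigma_k_eq_int
      numeral_fps_const fps_of_nat[symmetric] fps_const_power sigma_int_def[of _ 0] elim!: dvdE simp
          del: upt_rec_numeral)

text \<open>Expansions through \<open>q^18\<close>. The first three lists are checked against
  divisor sums, the other five through the recursions that these give.\<close>

definition qZ_list :: "int list" where
  "qZ_list = [1, -1, -5, -4, -13, -6, -20, -15, -29, -13, -30, -12, -52, -14, -75, -24, -61, -18, -65]"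

definition qT_list :: "int list" where
  "qT_list = [-1, -3, -3, -12, -3, -18, -12, -45, -3, -39, -18, -36, -12, -42, -45, -72, -3, -54, -39]"

definition qS_list :: "int list" where
  "qS_list = [1, -4, -4, -16, -4, -24, -16, -4, -4, -52, -24, -48, -16, -56, -4, -96, -4, -72, -52]"

definition qa_list :: "int list" where
  "qa_list = [1, -4, 4, 0, 4, -8, 0, -4, 20, -20, 8, -16, 32, -8, 4, -32, 36, -40, 20]"

definition qb_list :: "int list" where
  "qb_list = [0, 0, 8, 16, 8, 16, 16, 0, 24, 32, 32, 32, 48, 48, 8, 64, 40, 32, 72]"

definition qc_list :: "int list" where
  "qc_list = [0, 0, 1, -5, 8, -5, 9, -21, 17, -10, 11, -10, 27, -15, -20, -20, 40, -10, 23]"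

definition qe_list :: "int list" where
  "qe_list = [1, 3, 4, 7, 11, 13, 21, 24, 20, 29, 29, 26, 39, 27, 25, 52, 43, 44, 62]"

definition qf_list :: "int list" where
  "qf_list = [0, 1, -1, -2, 1, 0, 2, 1, -1, 1, 0, 0, -2, -4, -1, 0, 1, 6, -1]"

lemma coeffs_qZTS: "coeffs qZ_list qZ" "coeffs qT_list qT" "coeffs qS_list qS"
proof -
  have "coeffs (map2 (+) (map2 (+) (map2 (+) (eis_list 1 (int 1) (-24) 1) (eis_list 1 (int 2) (-24) 2))
      (eis_list 1 (int 7) (-24) 7)) (eis_list 1 (int 14) (-24) 14)) (24 * qZ)"
    unfolding qZ_eq by (intro coeffs_intros coeffs_eis) simp_all
  then show "coeffs qZ_list qZ"
    by (rule coeffs_cancel_numeral) code_simp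
  have "coeffs (map2 (-) (map2 (+) (map2 (-) (eis_list 1 (int 1) (-24) 1) (eis_list 1 (int 2) (-24) 2))
      (eis_list 1 (int 7) (-24) 7)) (eis_list 1 (int 14) (-24) 14)) (8 * qT)"
    unfolding qT_eq by (intro coeffs_intros coeffs_eis) simp_all
  then show "coeffs qT_list qT"
    by (rule coeffs_cancel_numeral) code_simp
  have "coeffs (map2 (+) (map2 (-) (map2 (-) (eis_list 1 (int 1) (-24) 1) (eis_list 1 (int 2) (-24) 2))
      (eis_list 1 (int 7) (-24) 7)) (eis_list 1 (int 14) (-24) 14)) (6 * qS)"
    unfolding qS_eq by (intro coeffs_intros coeffs_eis) simp_all
  then show "coeffs qS_list qS"
    by (rule coeffs_cancel_numeral) code_simp
qed

lemma coeffs_q: "coeffs qa_list qa" "coeffs qb_list qb" "coeffs qc_list qc" "coeffs qe_list qe" "coeffs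
    qf_list qf"
proof -
  have len: "length qa_list = 19" "length qb_list = 19" "length qc_list = 19" "length qe_list = 19"
      "length qf_list = 19"
    by code_simp+
  \<comment> \<open>These orders of vanishing equal the constant terms of the logarithmic
    derivatives, where the recursion leaves a coefficient free.\<close>
  have "qb $ 2 = 8" "qc $ 2 = 1" "qf $ 1 = 1"
    by (simp_all add: qb_def qc_def qf_def mult.assoc fps_numeral_mult_nth fps_X_power_mult_nth
        fps_power_zeroth)
  then have init: "qa $ 0 = of_int (qa_list ! 0)" "qb $ 2 = of_int (qb_list ! 2)" "qc $ 2 = of_int
      (qc_list ! 2)"
    "qe $ 0 = of_int (qe_list ! 0)" "qf $ 1 = of_int (qf_list ! 1)"
    by (simp_all add: qa_list_def qb_list_def qc_list_def qe_list_def qf_list_def)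
  have G: "coeffs (map2 (+) qZ_list qT_list) (qZ + qT)"
    by (intro coeffs_intros coeffs_qZTS)
  show "coeffs qa_list qa"
    by (rule coeffs_log_deriv[where k = 0, OF XD_q(1) G len(1) _ init(1)]) code_simp+
  have G: "coeffs (map2 (-) qZ_list qT_list) (qZ - qT)"
    by (intro coeffs_intros coeffs_qZTS)
  show "coeffs qb_list qb"
    by (rule coeffs_log_deriv[where k = 2, OF XD_q(2) G len(2) _ init(2)]) code_simp+
  have G: "coeffs (map2 (+) qZ_list qS_list) (qZ + qS)"
    by (intro coeffs_intros coeffs_qZTS)
  show "coeffs qc_list qc"
    by (rule coeffs_log_deriv[where k = 2, OF XD_q(3) G len(3) _ init(3)]) code_simp+
  have G: "coeffs (map2 (-) qZ_list qS_list) (qZ - qS)"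
    by (intro coeffs_intros coeffs_qZTS)
  show "coeffs qe_list qe"
    by (rule coeffs_log_deriv[where k = 0, OF XD_q(4) G len(4) _ init(4)]) code_simp+
  show "coeffs qf_list qf"
    by (rule coeffs_log_deriv[where k = 1, OF XD_q(5) coeffs_qZTS(1) len(5) _ init(5)]) code_simp+
qed

text \<open>These errors are computed directly; the other initial ones follow from the differential
  equations.\<close>

lemma errors_initial:
  assumes "n < 19"
  shows "err_x 1 $ n = 0" "err_x 2 $ n = 0" "err_x 7 $ n = 0" "err_x 14 $ n = 0" "err_y 1 $ n = 0"
      "err_r $ n = 0"
proof -
  have pos: "0 < (1::nat)" "0 < (2::nat)" "0 < (7::nat)" "0 < (14::nat)" by simp_all
  note base = coeffs_intros coeffs_qZTS coeffs_q coeffs_eis(1)[OF pos(1)] coeffs_eis(1)[OF pos(2)]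
    coeffs_eis(1)[OF pos(3)] coeffs_eis(1)[OF pos(4)] coeffs_eis(2)[OF pos(1)]
  show "err_x 1 $ n = 0" "err_x 2 $ n = 0" "err_x 7 $ n = 0" "err_x 14 $ n = 0"
    unfolding err_x_def at_cusp_simps lin_def
    by (rule coeffs_zero[OF _ _ assms], (rule base)+, code_simp)+
  show "err_y 1 $ n = 0"
    unfolding err_y_def at_cusp_simps quad_def
    by (rule coeffs_zero[OF _ _ assms], (rule base)+, code_simp)
  show "err_r $ n = 0"
    unfolding err_r_def
    by (rule coeffs_zero[OF _ _ assms], (rule base)+, code_simp)
qed

lemma err_ts_initial:
  assumes "n < 19"
  shows "err_t $ n = 0" "err_s $ n = 0"
  using err_t_eq[THEN arg_cong[where f = "\<lambda>F. F $ n"]] err_s_eq[THEN arg_cong[where f =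
      "\<lambda>F. F $ n"]]
    errors_initial[OF assms]
  by (simp_all add: fps_numeral_mult_nth)

lemma errors_vanish_initial:
  assumes "n < 19"
  shows "errors_vanish n"
proof -
  have mult: "(F * G) $ n = 0" if "n < 19" "\<And>k. k < 19 \<Longrightarrow> G $ k = 0" for F G ::
      "real fps" and n
    unfolding fps_mult_nth using that by (intro sum.neutral) auto
  have lx: "err_x d $ k = 0" if "d \<in> {1, 2, 7, 14}" "k < 19" for d k
    using errors_initial[of k] that by auto
  note mults = mult[OF _ lx] mult[OF _ err_ts_initial(1)] mult[OF _ err_ts_initial(2)]
  \<comment> \<open>With \<open>err_x\<close>, \<open>err_t\<close>, \<open>err_s\<close> zero below
    \<open>q^19\<close>, the first equation makes all \<open>err_y d\<close> equal there, hence
    equal to \<open>err_y 1\<close>.\<close>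
  have y: "4 * err_y d $ n = - err_z $ n" if "d \<in> {1, 2, 7, 14}" "n < 19" for d n
    using that error_equations_1(1)[THEN arg_cong[where f = "\<lambda>F. F $ n"]]
      error_equations_2(1)[THEN arg_cong[where f = "\<lambda>F. F $ n"]]
      error_equations_7(1)[THEN arg_cong[where f = "\<lambda>F. F $ n"]]
      error_equations_14(1)[THEN arg_cong[where f = "\<lambda>F. F $ n"]]
    by (auto simp: mults fps_numeral_mult_nth lx simp del: One_nat_def)
  have ly: "err_y d $ n = 0" if "d \<in> {1, 2, 7, 14}" "n < 19" for d n
    using y[OF that] y[of 1 n] errors_initial(5)[OF that(2)] that(2) by simp
  \<comment> \<open>The second equation now expresses \<open>err_w d\<close> by errors already known
    to vanish.\<close>
  have "err_w d $ n = 0" if "d \<in> {1, 2, 7, 14}" for d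
    using that assms error_equations_1(2)[THEN arg_cong[where f = "\<lambda>F. F $ n"]]
      error_equations_2(2)[THEN arg_cong[where f = "\<lambda>F. F $ n"]]
      error_equations_7(2)[THEN arg_cong[where f = "\<lambda>F. F $ n"]]
      error_equations_14(2)[THEN arg_cong[where f = "\<lambda>F. F $ n"]]
    by (auto simp: mults mult[OF _ ly] fps_numeral_mult_nth lx ly simp del: One_nat_def)
  then show ?thesis
    using lx[OF _ assms] ly[OF _ assms] errors_initial(6)[OF assms] unfolding errors_vanish_def by blast
qed

lemma errors_vanish: "errors_vanish n"
proof (induction n rule: less_induct)
  case (less n)
  then show ?case
    using errors_vanish_initial[of n] errors_vanish_step[of n] by (cases "n < 19") auto
qed

section \<open>The resulting identities of level 14\<close>

lemma eis_eq:
  assumes "d \<in> {1, 2, 7, 14}"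
  shows "eis2 d = 6 * qZ + at_cusp d lin" "eis4 d = at_cusp d quad"
proof -
  have "err_x d = 0" "err_y d = 0"
    using assms errors_vanish unfolding errors_vanish_def fps_eq_iff fps_zero_nth by blast+
  then show "eis2 d = 6 * qZ + at_cusp d lin" "eis4 d = at_cusp d quad"
    by (auto simp: err_x_def err_y_def algebra_simps)
qed

lemma q_relation: "qc + qe = qa + qb + 7 * qf"
proof -
  have "err_r = 0"
    using errors_vanish unfolding errors_vanish_def fps_eq_iff fps_zero_nth by blast
  then show ?thesis by (simp add: err_r_def algebra_simps)
qed

lemma eis2_2_7: "250 * (eis2 2 * eis2 7) = 14 * eis4 1 + 14 * eis4 2 + 14 * eis4 7 + 14 * eis4 14
    + 1500 * fps_XD (eis2 2) + 1500 * fps_XD (eis2 7)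
    - 3360 * (qf * qa) - 480 * qf ^ 2 - 3360 * (qf * qb) - 48000 * (qf * qc)"
proof -
  have e: "eis2 2 = 6 * qZ + at_cusp 2 lin" "eis2 7 = 6 * qZ + at_cusp 7 lin" "eis4 1 = at_cusp 1 quad"
    "eis4 2 = at_cusp 2 quad" "eis4 7 = at_cusp 7 quad" "eis4 14 = at_cusp 14 quad"
    by (rule eis_eq; simp)+
  have qe: "qe = qa + qb + 7 * qf - qc" using q_relation by (simp add: algebra_simps)
  \<comment> \<open>\<open>6 * qZ\<close> cancels in the difference, which leaves an identity of
    quadratic forms modulo the three relations between the eta quotients.\<close>
  have "125 * (eis2 2 - eis2 7) ^ 2 = - 14 * eis4 1 + 111 * eis4 2 + 111 * eis4 7 - 14 * eis4 14
      + 3360 * (qf * qa) + 480 * qf ^ 2 + 3360 * (qf * qb) + 48000 * (qf * qc)"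
    unfolding e at_cusp_simps form_defs
    using q_products q_relation by algebra
  moreover have "eis2 2 ^ 2 = 12 * fps_XD (eis2 2) + eis4 2" "eis2 7 ^ 2 = 12 * fps_XD (eis2 7) + eis4
      7"
    using ramanujan(1)[of 2] ramanujan(1)[of 7] by (simp_all add: algebra_simps)
  \<comment> \<open>\<open>250 u v = 125 (u^2 + v^2 - (u - v)^2)\<close>, which also gives
    \<open>125 - 111 = 14\<close> as coefficient of \<open>eis4 2\<close> and
    \<open>eis4 7\<close>.\<close>
  ultimately show ?thesis by algebra
qed

section \<open>The convolution sum\<close>

text \<open>The indices of the Cauchy product are \<open>i = \<alpha> * l\<close> and
  \<open>n - i = \<beta> * m\<close>; other indices contribute zero.\<close>

lemma W_eq_nth:
  assumes "\<alpha> > 0" "\<beta> > 0"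
  shows "W \<alpha> \<beta> n = (dilate \<alpha> (lambert 1) * dilate \<beta> (lambert 1)) $ n"
proof -
  have "(dilate \<alpha> (lambert 1) * dilate \<beta> (lambert 1)) $ n
      = (\<Sum>i \<in> {i \<in> {0..n}. \<alpha> dvd i \<and> \<beta> dvd (n - i)}. sigma_k 1 (i div
          \<alpha>) * sigma_k 1 ((n - i) div \<beta>))"
    using assms by (subst sum.inter_filter) (auto simp: fps_mult_nth dilate_nth lambert_nth intro!:
        sum.cong)
  also have "\<dots> = W \<alpha> \<beta> n"
    unfolding W_def
  proof (rule sum.reindex_bij_witness[where i = "\<lambda>(l, m). \<alpha> * l" and j = "\<lambda>i. (i
      div \<alpha>, (n - i) div \<beta>)"])
    fix p assume "p \<in> {(l, m). l \<le> n \<and> m \<le> n \<and> \<alpha> * l + \<beta> * m = n}"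
    then show "(case p of (l, m) \<Rightarrow> \<alpha> * l) \<in> {i \<in> {0..n}. \<alpha> dvd i
        \<and> \<beta> dvd n - i}"
      "((case p of (l, m) \<Rightarrow> \<alpha> * l) div \<alpha>, (n - (case p of (l, m)
          \<Rightarrow> \<alpha> * l)) div \<beta>) = p"
      using assms by auto
  next
    fix i assume i: "i \<in> {i \<in> {0..n}. \<alpha> dvd i \<and> \<beta> dvd n - i}"
    then show "(i div \<alpha>, (n - i) div \<beta>) \<in> {(l, m). l \<le> n \<and> m \<le> n \<and>
        \<alpha> * l + \<beta> * m = n}"
      by (auto intro: order_trans[OF div_le_dividend])
  qed auto
  finally show ?thesis ..
qed

lemma sigma_k_frac_eq: "d > 0 \<Longrightarrow> sigma_k_frac k n d = dilate d (lambert k) $ n"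
  by (simp add: sigma_k_frac_def dilate_nth lambert_nth)

text \<open>Coefficient \<open>n\<close> does not distinguish the truncations from the full
  products, whose exponents then add. The factor 8 comes from \<open>qb\<close>.\<close>

lemma eta_quotient_coeffs:
  "a1 n = (qf * qa) $ n" "a2 n = (qf ^ 2) $ n" "8 * a3 n = (qf * qb) $ n" "a4 n = (qf * qc) $ n"
proof -
  note intros = eq_upto_mult eq_upto_power eq_upto_inverse eq_upto_refl eta_trunc_eq_upto
  have nth: "F $ n = G $ n" if "eq_upto n F G" for F G using that by (simp add: eq_upto_def)
  have "a1 n = (fps_X ^ 1 * eta 1 ^ 5 * eta 7 ^ 5 * inverse (eta 2 * eta 14)) $ n"
    unfolding a1_def by (rule nth) (intro intros; simp)
  also have "fps_X ^ 1 * eta 1 ^ 5 * eta 7 ^ 5 * inverse (eta 2 * eta 14) = qf * qa"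
    unfolding qf_def qa_def fps_inverse_mult using inverse_eta[of 2] inverse_eta[of 14] by algebra
  finally show "a1 n = (qf * qa) $ n" .
  have "a2 n = (fps_X ^ 2 * eta 1 ^ 2 * eta 2 ^ 2 * eta 7 ^ 2 * eta 14 ^ 2) $ n"
    unfolding a2_def by (rule nth) (intro intros; simp)
  also have "fps_X ^ 2 * eta 1 ^ 2 * eta 2 ^ 2 * eta 7 ^ 2 * eta 14 ^ 2 = qf ^ 2"
    unfolding qf_def by algebra
  finally show "a2 n = (qf ^ 2) $ n" .
  have "a3 n = (fps_X ^ 3 * eta 2 ^ 5 * eta 14 ^ 5 * inverse (eta 1 * eta 7)) $ n"
    unfolding a3_def by (rule nth) (intro intros; simp)
  then have "8 * a3 n = (8 * (fps_X ^ 3 * eta 2 ^ 5 * eta 14 ^ 5 * inverse (eta 1 * eta 7))) $ n"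
    by (simp add: fps_numeral_mult_nth)
  also have "8 * (fps_X ^ 3 * eta 2 ^ 5 * eta 14 ^ 5 * inverse (eta 1 * eta 7)) = qf * qb"
    unfolding qf_def qb_def fps_inverse_mult using inverse_eta[of 1] inverse_eta[of 7] by algebra
  finally show "8 * a3 n = (qf * qb) $ n" .
  have "a4 n = (fps_X ^ 3 * eta 1 ^ 6 * eta 14 ^ 6 * inverse (eta 2 ^ 2 * eta 7 ^ 2)) $ n"
    unfolding a4_def by (rule nth) (intro intros; simp add: fps_power_zeroth)
  also have "fps_X ^ 3 * eta 1 ^ 6 * eta 14 ^ 6 * inverse (eta 2 ^ 2 * eta 7 ^ 2) = qf * qc"
    unfolding qf_def qc_def fps_inverse_mult fps_inverse_power
    using inverse_eta[of 2] inverse_eta[of 7] by algebra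
  finally show "a4 n = (qf * qc) $ n" .
qed

lemma eis2_eq: "d > 0 \<Longrightarrow> eis2 d = of_nat d - 24 * of_nat d * dilate d (lambert 1)"
  by (auto simp: fps_eq_iff eis2_def dilate_nth lambert_nth numeral_fps_const fps_of_nat[symmetric]
      mult.assoc)

lemma eis4_nth: "d > 0 \<Longrightarrow> n > 0 \<Longrightarrow> eis4 d $ n = 240 * real d ^ 2 * dilate
    d (lambert 3) $ n"
  by (auto simp: eis4_def dilate_nth numeral_fps_const fps_of_nat[symmetric] elim!: dvdE)

theorem theorem3p3:
  fixes n :: nat
  assumes "n \<ge> 1"
  shows "W 2 7 n =
      1/600 * sigma_k 3 n + 1/150 * sigma_k_frac 3 n 2
    + 49/600 * sigma_k_frac 3 n 7 + 49/150 * sigma_k_frac 3 n 14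
    + (1/24 - real n / 28) * sigma_k_frac 1 n 2
    + (1/24 - real n / 8) * sigma_k_frac 1 n 7
    - 1/600 * a1 n - 1/4200 * a2 n - 1/75 * a3 n - 1/42 * a4 n"
proof -
  define l2 l7 where "l2 = dilate 2 (lambert 1)" and "l7 = dilate 7 (lambert 1)"
  have n: "n > 0" using assms by simp
  have e2: "eis2 2 = 2 - 48 * l2" and e7: "eis2 7 = 7 - 168 * l7"
    by (simp_all add: eis2_eq l2_def l7_def)
  have XD: "fps_XD (eis2 2) $ n = - 48 * real n * l2 $ n" "fps_XD (eis2 7) $ n = - 168 * real n * l7 $ n"
    unfolding e2 e7 using n by (simp_all add: fps_numeral_mult_nth fps_numeral_nth)
  have "eis2 2 * eis2 7 = 14 - 336 * l2 - 336 * l7 + 8064 * (l2 * l7)"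
    unfolding e2 e7 by algebra
  then have "(eis2 2 * eis2 7) $ n = - 336 * l2 $ n - 336 * l7 $ n + 8064 * (l2 * l7) $ n"
    using n by (simp add: fps_numeral_mult_nth fps_numeral_nth)
  moreover have "250 * (eis2 2 * eis2 7) $ n = 14 * eis4 1 $ n + 14 * eis4 2 $ n + 14 * eis4 7 $ n
      + 14 * eis4 14 $ n + 1500 * fps_XD (eis2 2) $ n + 1500 * fps_XD (eis2 7) $ n
      - 3360 * (qf * qa) $ n - 480 * (qf ^ 2) $ n - 3360 * (qf * qb) $ n - 48000 * (qf * qc) $ n"
    using eis2_2_7[THEN arg_cong[where f = "\<lambda>F. F $ n"]]
    by (simp only: fps_numeral_mult_nth fps_add_nth fps_sub_nth)
  \<comment> \<open>\<open>2016000 = 250 * 8064\<close>, and \<open>26880 = 8 * 3360\<close> because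
    \<open>qf * qb\<close> expands to \<open>8 * a3\<close>. Division by \<open>2016000\<close>
    produces the stated fractions.\<close>
  ultimately have main: "2016000 * (l2 * l7) $ n = 84000 * (l2 $ n + l7 $ n)
      + 14 * (eis4 1 $ n + eis4 2 $ n + eis4 7 $ n + eis4 14 $ n)
      - 72000 * (real n * l2 $ n) - 252000 * (real n * l7 $ n)
      - 3360 * a1 n - 480 * a2 n - 26880 * a3 n - 48000 * a4 n"
    unfolding XD eta_quotient_coeffs(1,2,4) eta_quotient_coeffs(3)[symmetric] by simp
  have eis: "eis4 1 $ n = 240 * sigma_k 3 n" "eis4 2 $ n = 960 * sigma_k_frac 3 n 2"
    "eis4 7 $ n = 11760 * sigma_k_frac 3 n 7" "eis4 14 $ n = 47040 * sigma_k_frac 3 n 14"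
    using n by (simp_all add: eis4_nth sigma_k_frac_eq dilate_nth lambert_nth)
  have l: "l2 $ n = sigma_k_frac 1 n 2" "l7 $ n = sigma_k_frac 1 n 7" "(l2 * l7) $ n = W 2 7 n"
    by (simp_all add: l2_def l7_def sigma_k_frac_eq W_eq_nth)
  from main show ?thesis
    unfolding eis l by (simp add: field_simps)
qed

end
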